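(* Let $G$ be a finitely generated group and let $X$ be a Cayley graph of $G$. Then every cyclic subgroup of $$\mathcal{C}_1^X(G)=\mathrm{Comm}_{\mathrm{Aut}(X)}(G)\cap \mathrm{Aut}_1(X)$$ is undistorted.
   Context: Cayley graphs. For a group $G$ with finite generating set $S$, the (unlabelled) Cayley graph $\mathrm{Cay}(G,S)$ is the directed graph with vertex set $G$ and edge set $\{(g,gs)\mid g\in G, s\in S\cup S^{-1}\}$. A Cayley graph of $G$ means $\mathrm{Cay}(G,S)$ for some finite generating set $S$. $\mathrm{Aut}(X)$ is the group of automorphisms of $X$ as an unlabelled graph, $\mathrm{Aut}_1(X)$ is the stabiliser of the vertex $1\in G$, and $G$ is regarded as a subgroup of $\mathrm{Aut}(X)$ through left multiplication. Commensurator. For $H\leq K$, $\mathrm{Comm}_K(H)=\{k\in K\mid [H:H\cap kHk^{-1}]<\infty,\ [kHk^{-1}:H\cap kHk^{-1}]<\infty\}$. Distortion. If $K$ is a group generated by a finite set $S$ and $H\leq K$ is generated by a finite set $T\subseteq H$, then $H$ is undistorted in $K$ if there is $C\in\mathbb{R}_{>0}$ with $|h|_T\leq C|h|_S$ for all $h\in H$, where $|\cdot|_T,|\cdot|_S$ are the word metrics in $H$ and $K$ with respect to $T$ and $S$ (this is independent of the choice of $S$ and $T$). If $L$ is a group that is not necessarily finitely generated, a finitely generated subgroup $H\leq L$ is undistorted in $L$ if $H$ is undistorted in $K$ for every finitely generated subgroup $K\leq L$ containing $H$. *)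

theory Defs
  imports
    "HOL-Algebra.Bij"
    "HOL-Algebra.Elementary_Groups"
    "HOL-Algebra.Group_Action"
    "Graph_Theory.Pair_Digraph"
begin

section \<open>Finitely generated groups and word metrics\<close>

definition generates :: "('a, 'b) monoid_scheme \<Rightarrow> 'a set \<Rightarrow> bool" where
  "generates K S \<longleftrightarrow> S \<subseteq> carrier K \<and> generate K S = carrier K"

definition finitely_generated :: "('a, 'b) monoid_scheme \<Rightarrow> bool" where
  "finitely_generated K \<longleftrightarrow> (\<exists>S. finite S \<and> generates K S)"

text \<open>The value is meaningful only for elements of the subgroup generated by \<open>S\<close>.\<close>

definition word_length :: "('a, 'b) monoid_scheme \<Rightarrow> 'a set \<Rightarrow> 'a \<Rightarrow> nat" where
  "word_length K S g =
    (LEAST n. \<exists>ws. length ws = n \<and> set ws \<subseteq> S \<union> set_inv\<^bsub>K\<^esub> S \<and>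
                   foldr (\<otimes>\<^bsub>K\<^esub>) ws \<one>\<^bsub>K\<^esub> = g)"


section \<open>Distortion\<close>

text \<open>
  Whether the inequality below can be satisfied does not depend on the finite generating sets
  \<open>S\<close> and \<open>T\<close>; it is required for all of them, and the finite generation of both groups
  ensures that the requirement is not vacuous.
\<close>

definition undistorted_fg :: "('a, 'b) monoid_scheme \<Rightarrow> 'a set \<Rightarrow> bool" where
  "undistorted_fg K H \<longleftrightarrow>
    finitely_generated K \<and> finitely_generated (K\<lparr>carrier := H\<rparr>) \<and>
    (\<forall>S T. finite S \<longrightarrow> generates K S \<longrightarrow> finite T \<longrightarrow> generates (K\<lparr>carrier := H\<rparr>) T \<longrightarrow>
      (\<exists>C::real. C > 0 \<and>
        (\<forall>h\<in>H. real (word_length (K\<lparr>carrier := H\<rparr>) T h) \<le> C * real (word_length K S h))))"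

definition undistorted :: "('a, 'b) monoid_scheme \<Rightarrow> 'a set \<Rightarrow> bool" where
  "undistorted L H \<longleftrightarrow>
    finitely_generated (L\<lparr>carrier := H\<rparr>) \<and>
    (\<forall>K. subgroup K L \<longrightarrow> finitely_generated (L\<lparr>carrier := K\<rparr>) \<longrightarrow> H \<subseteq> K \<longrightarrow>
      undistorted_fg (L\<lparr>carrier := K\<rparr>) H)"


section \<open>Commensurators\<close>

definition finite_index :: "('a, 'b) monoid_scheme \<Rightarrow> 'a set \<Rightarrow> 'a set \<Rightarrow> bool" where
  "finite_index K A B \<longleftrightarrow> finite (rcosets\<^bsub>K\<lparr>carrier := A\<rparr>\<^esub> B)"

definition conjugate :: "('a, 'b) monoid_scheme \<Rightarrow> 'a \<Rightarrow> 'a set \<Rightarrow> 'a set" where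
  "conjugate K k H = k <#\<^bsub>K\<^esub> H #>\<^bsub>K\<^esub> (inv\<^bsub>K\<^esub> k)"

definition commensurator :: "('a, 'b) monoid_scheme \<Rightarrow> 'a set \<Rightarrow> 'a set" where
  "commensurator K H =
    {k \<in> carrier K. finite_index K H (H \<inter> conjugate K k H) \<and>
                    finite_index K (conjugate K k H) (H \<inter> conjugate K k H)}"


section \<open>Cayley graphs and their automorphisms\<close>

text \<open>
  The arcs form a set of pairs, so they carry no labels and no multiplicities.
\<close>

definition Cay :: "('a, 'b) monoid_scheme \<Rightarrow> 'a set \<Rightarrow> 'a pair_pre_digraph" where
  "Cay G S =
    \<lparr> pverts = carrier G,
      parcs = {(g, g \<otimes>\<^bsub>G\<^esub> s) | g s. g \<in> carrier G \<and> s \<in> S \<union> set_inv\<^bsub>G\<^esub> S} \<rparr>"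

definition is_cayley_graph :: "('a, 'b) monoid_scheme \<Rightarrow> 'a pair_pre_digraph \<Rightarrow> bool" where
  "is_cayley_graph G X \<longleftrightarrow> (\<exists>S. finite S \<and> generates G S \<and> X = Cay G S)"

text \<open>
  As in \<^const>\<open>BijGroup\<close>, a permutation of the vertices is represented by the function that is
  \<^const>\<open>undefined\<close> off the vertex set, and the product of \<open>\<phi>\<close> and \<open>\<psi>\<close> is \<open>\<phi> \<circ> \<psi>\<close>.
\<close>

definition graph_auto :: "'a pair_pre_digraph \<Rightarrow> ('a \<Rightarrow> 'a) set" where
  "graph_auto X =
    {\<phi> \<in> Bij (pverts X).
      \<forall>u \<in> pverts X. \<forall>v \<in> pverts X. (u, v) \<in> parcs X \<longleftrightarrow> (\<phi> u, \<phi> v) \<in> parcs X}"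

definition Aut :: "'a pair_pre_digraph \<Rightarrow> ('a \<Rightarrow> 'a) monoid" where
  "Aut X = BijGroup (pverts X) \<lparr>carrier := graph_auto X\<rparr>"

definition left_translations :: "('a, 'b) monoid_scheme \<Rightarrow> ('a \<Rightarrow> 'a) set" where
  "left_translations G = (\<lambda>g. \<lambda>x\<in>carrier G. g \<otimes>\<^bsub>G\<^esub> x) ` carrier G"

text \<open>The group \<open>C\<^sub>1\<^sup>X(G) = Comm(G) \<inter> Aut\<^sub>1(X)\<close>, the commensurator being taken in \<open>Aut(X)\<close>.\<close>

definition C1 :: "('a, 'b) monoid_scheme \<Rightarrow> 'a pair_pre_digraph \<Rightarrow> ('a \<Rightarrow> 'a) monoid" where
  "C1 G X =
    (Aut X) \<lparr>carrier := commensurator (Aut X) (left_translations G) \<inter>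
                        stabilizer (Aut X) (\<lambda>\<phi>. \<phi>) \<one>\<^bsub>G\<^esub>\<rparr>"


section \<open>Basic facts\<close>

lemma subgroup_graph_auto: "subgroup (graph_auto X) (BijGroup (pverts X))"
proof (rule group.subgroupI[OF group_BijGroup])
  show "graph_auto X \<subseteq> carrier (BijGroup (pverts X))"
    by (auto simp: graph_auto_def BijGroup_def)
  show "graph_auto X \<noteq> {}"
    using id_Bij[of "pverts X"] by (force simp: graph_auto_def)
next
  fix f assume f: "f \<in> graph_auto X"
  then have fB: "f \<in> Bij (pverts X)" by (simp add: graph_auto_def)
  let ?g = "inv_into (pverts X) f"
  have fg: "f (?g u) = u" "?g u \<in> pverts X" if "u \<in> pverts X" for u
    using fB that by (auto simp: Bij_def bij_betw_def f_inv_into_f inv_into_into)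
  have "(u, v) \<in> parcs X \<longleftrightarrow> (?g u, ?g v) \<in> parcs X" if "u \<in> pverts X" "v \<in> pverts X" for u v
    using f fg[OF that(1)] fg[OF that(2)] by (auto simp: graph_auto_def)
  then show "inv\<^bsub>BijGroup (pverts X)\<^esub> f \<in> graph_auto X"
    using restrict_inv_into_Bij[OF fB] by (simp add: inv_BijGroup[OF fB] graph_auto_def)
next
  fix f g assume fg: "f \<in> graph_auto X" "g \<in> graph_auto X"
  then have B: "f \<in> Bij (pverts X)" "g \<in> Bij (pverts X)" by (auto simp: graph_auto_def)
  then have "g u \<in> pverts X" if "u \<in> pverts X" for u
    using that Bij_imp_funcset by blast
  then show "f \<otimes>\<^bsub>BijGroup (pverts X)\<^esub> g \<in> graph_auto X"
    using fg B compose_Bij[OF B] by (simp add: BijGroup_def graph_auto_def compose_eq)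
qed

lemma group_Aut: "group (Aut X)"
  unfolding Aut_def by (rule subgroup.subgroup_is_group[OF subgroup_graph_auto group_BijGroup])

lemma (in group) left_translation_graph_auto:
  assumes S: "S \<subseteq> carrier G" and g: "g \<in> carrier G"
  shows "(\<lambda>x\<in>carrier G. g \<otimes> x) \<in> graph_auto (Cay G S)"
proof -
  have "bij_betw (\<lambda>x\<in>carrier G. g \<otimes> x) (carrier G) (carrier G)"
    by (rule bij_betw_byWitness[where f' = "\<lambda>x. inv g \<otimes> x"])
       (use g in \<open>auto simp: m_assoc[symmetric]\<close>)
  moreover have "(u, v) \<in> parcs (Cay G S) \<longleftrightarrow> (g \<otimes> u, g \<otimes> v) \<in> parcs (Cay G S)"
    if uv: "u \<in> carrier G" "v \<in> carrier G" for u v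
  proof -
    have T: "S \<union> set_inv S \<subseteq> carrier G" using S by (auto simp: SET_INV_def)
    have "v = u \<otimes> s \<longleftrightarrow> g \<otimes> v = g \<otimes> u \<otimes> s" if "s \<in> S \<union> set_inv S" for s
      using that T uv g by (auto simp: m_assoc)
    then show ?thesis using uv g by (simp add: Cay_def) blast
  qed
  ultimately show ?thesis
    by (auto simp: graph_auto_def Bij_def Cay_def)
qed

lemma (in group) subgroup_left_translations:
  assumes "S \<subseteq> carrier G"
  shows "subgroup (left_translations G) (Aut (Cay G S))"
proof -
  let ?l = "\<lambda>g. \<lambda>x\<in>carrier G. g \<otimes> x"
  let ?A = "Aut (Cay G S)"
  have A: "?l g \<in> graph_auto (Cay G S)" if "g \<in> carrier G" for g
    by (rule left_translation_graph_auto[OF assms that])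
  then have B: "?l g \<in> Bij (carrier G)" if "g \<in> carrier G" for g
    using that by (auto simp: graph_auto_def Cay_def)
  have "?l \<in> hom G ?A"
  proof (rule homI)
    fix x y assume xy: "x \<in> carrier G" "y \<in> carrier G"
    then show "?l (x \<otimes> y) = ?l x \<otimes>\<^bsub>?A\<^esub> ?l y"
      using B[OF xy(1)] B[OF xy(2)]
      by (auto simp: Aut_def BijGroup_def Cay_def compose_def m_assoc intro!: restrict_ext)
  qed (use A in \<open>simp add: Aut_def\<close>)
  then interpret l: group_hom G ?A ?l
    by (intro group_hom.intro group_hom_axioms.intro is_group group_Aut)
  show ?thesis unfolding left_translations_def by (rule l.img_is_subgroup)
qed

end

theory Submission
  imports Defs
begin

text \<open>
Let \<open>\<Gamma> = Aut X\<close>, let \<open>L\<close> be the group of left translations, and let \<open>\<phi>\<close> be an element of \<open>\<Gamma>\<close> that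
commensurates \<open>L\<close> and fixes the vertex \<open>1\<close>. For a subgroup \<open>U\<close> of finite index in \<open>L\<close>, the
index \<open>f k = [U : U \<inter> k U k\<^sup>-\<^sup>1]\<close> is a submultiplicative function on the commensurator, so on a
finitely generated subgroup it is at most exponential in the word length. If \<open>f (\<phi>^n)\<close> grows
exponentially in \<open>n\<close>, then the word length of \<open>\<phi>^n\<close> is at least linear in \<open>n\<close>, which is
undistortedness (\<open>undistorted_fg_of_exponential_index\<close>).

The heart of the proof is a dichotomy: for a suitable \<open>U\<close>, the index \<open>f (\<phi>^n)\<close> is either bounded or
exponential in \<open>n\<close> (\<open>conjugate_index_dichotomy\<close>). It is a version for commensurated subgroups of the
scale function and the tidy subgroups of Willis. Put \<open>U\<^sub>i = \<phi>^i U \<phi>^-i\<close>. One takes for \<open>U\<close> the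
intersection of the first \<open>m + 1\<close> conjugates \<open>\<phi>^i L \<phi>^-i\<close>, where \<open>m\<close> is so large that the index
by which the intersection drops when a further conjugate is added no longer changes. Then \<open>U\<^sub>i\<close>
is, for every interval around \<open>i\<close>, the product of the two intersections of the \<open>U\<^sub>j\<close> over the parts
of the interval on either side of \<open>i\<close> (\<open>window_factor\<close>). Picture a graph on the cosets of the \<open>U\<^sub>i\<close>,
with an edge from a coset of \<open>U\<^sub>i\<close> to each coset of \<open>U\<^sub>i\<^sub>+\<^sub>1\<close> that it meets: paths can be
concatenated freely, every vertex has the same number \<open>c\<close> of outgoing edges, and
\<open>a n = [U\<^sub>0 : U\<^sub>0 \<inter> U\<^sub>n]\<close> counts the vertices that are reached from a given one in \<open>n\<close> steps. If
\<open>l n\<close> is the number of first edges of the paths of length \<open>n\<close> with given end points, then counting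
gives \<open>a n * l n = c * a (n - 1)\<close>. The sequence \<open>l\<close> is nondecreasing and at most \<open>c\<close>. Either it
reaches \<open>c\<close>, and \<open>a\<close> is constant from there on, or \<open>a n \<ge> (c / (c - 1))^n\<close>.

In the bounded case \<open>\<phi>\<close> has finite order, so the cyclic group is finite and there is nothing to
show. Indeed, some power \<open>\<phi>^q\<close> with \<open>q > 0\<close> fixes a ball around \<open>1\<close> pointwise, and it satisfies
\<open>\<phi>^-q (e x) = \<phi>^-q (e) \<phi>^-q (x)\<close> for all \<open>e\<close> in a subgroup of index at most \<open>N\<close>, where \<open>N\<close> does
not depend on \<open>q\<close>. The ball can therefore be chosen first, of radius \<open>N + 1\<close>; a ball of radius \<open>N\<close>
meets all cosets of every subgroup of index at most \<open>N\<close>, and this forces \<open>\<phi>^q = 1\<close>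
(\<open>fixes_all_of_fixes_ball\<close>, \<open>finite_order_of_bounded_index\<close>).
\<close>

section \<open>Relative indices of subgroups\<close>

text \<open>
The group \<open>B\<close> need not be contained in \<open>A\<close>: the cosets of \<open>B\<close> that meet \<open>A\<close> correspond to the cosets
of \<open>A \<inter> B\<close> in \<open>A\<close>, and their number is the index of \<open>A \<inter> B\<close> in \<open>A\<close>. This convention saves many
intersections.
\<close>

definition rel_cosets :: "('a, 'b) monoid_scheme \<Rightarrow> 'a set \<Rightarrow> 'a set \<Rightarrow> 'a set set" where
  "rel_cosets K A B = (\<lambda>a. B #>\<^bsub>K\<^esub> a) ` A"

definition rel_index :: "('a, 'b) monoid_scheme \<Rightarrow> 'a set \<Rightarrow> 'a set \<Rightarrow> nat" where
  "rel_index K A B = card (rel_cosets K A B)"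

context group
begin

lemma mult_inv_cancel:
  assumes "k \<in> carrier G" "x \<in> carrier G"
  shows "inv k \<otimes> (k \<otimes> x) = x" "k \<otimes> (inv k \<otimes> x) = x"
  using assms by (simp_all add: m_assoc[symmetric])

lemma rcos_eq_iff:
  assumes "subgroup B G" "x \<in> carrier G" "y \<in> carrier G"
  shows "B #> x = B #> y \<longleftrightarrow> x \<otimes> inv y \<in> B"
proof
  assume "B #> x = B #> y"
  then have "x \<in> B #> y" using rcos_self assms by blast
  then obtain b where "b \<in> B" "x = b \<otimes> y" by (auto simp: r_coset_def)
  then show "x \<otimes> inv y \<in> B"
    using assms by (metis inv_solve_right subgroup.mem_carrier)
next
  assume b: "x \<otimes> inv y \<in> B"
  have "x = (x \<otimes> inv y) \<otimes> y" using assms by (simp add: m_assoc)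
  then have "x \<in> B #> y" using b by (auto simp: r_coset_def)
  then show "B #> x = B #> y" using assms repr_independence by blast
qed

text \<open>
The tower law behind the multiplicativity of the index: with chosen representatives \<open>t\<close> in \<open>A\<close> of
the cosets of \<open>B\<close> and \<open>s\<close> in \<open>A \<inter> B\<close> of the cosets of \<open>C\<close>, the products \<open>s t\<close> represent the cosets
of \<open>B \<inter> C\<close>. As a bijection it serves both for cardinalities and for finiteness.
\<close>

lemma rel_cosets_Int_bij:
  assumes A: "subgroup A G" and B: "subgroup B G" and C: "subgroup C G"
  shows "\<exists>f. bij_betw f (rel_cosets G A B \<times> rel_cosets G (A \<inter> B) C) (rel_cosets G A (B \<inter> C))"
proof -
  have BC: "subgroup (B \<inter> C) G" using B C by (rule subgroups_Inter_pair)
  have Ac: "\<And>a. a \<in> A \<Longrightarrow> a \<in> carrier G" using A by (rule subgroup.mem_carrier)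
  define t where "t = inv_into A (\<lambda>a. B #> a)"
  define s where "s = inv_into (A \<inter> B) (\<lambda>a. C #> a)"
  have t: "t Q \<in> A" "B #> t Q = Q" if "Q \<in> rel_cosets G A B" for Q
    using that inv_into_into[of Q "\<lambda>a. B #> a" A] f_inv_into_f[of Q "\<lambda>a. B #> a" A]
    by (auto simp: t_def rel_cosets_def)
  have s: "s R \<in> A" "s R \<in> B" "C #> s R = R" if "R \<in> rel_cosets G (A \<inter> B) C" for R
    using that inv_into_into[of R "\<lambda>a. C #> a" "A \<inter> B"] f_inv_into_f[of R "\<lambda>a. C #> a" "A \<inter> B"]
    by (auto simp: s_def rel_cosets_def)
  let ?f = "\<lambda>(Q, R). (B \<inter> C) #> (s R \<otimes> t Q)"
  have "bij_betw ?f (rel_cosets G A B \<times> rel_cosets G (A \<inter> B) C) (rel_cosets G A (B \<inter> C))"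
  proof (rule bij_betw_imageI)
    show "inj_on ?f (rel_cosets G A B \<times> rel_cosets G (A \<inter> B) C)"
    proof (rule inj_onI, clarify)
      fix Q R Q' R'
      assume Q: "Q \<in> rel_cosets G A B" and Q': "Q' \<in> rel_cosets G A B"
        and R: "R \<in> rel_cosets G (A \<inter> B) C" and R': "R' \<in> rel_cosets G (A \<inter> B) C"
        and eq: "(B \<inter> C) #> (s R \<otimes> t Q) = (B \<inter> C) #> (s R' \<otimes> t Q')"
      note c = Ac[OF t(1)[OF Q]] Ac[OF t(1)[OF Q']] Ac[OF s(1)[OF R]] Ac[OF s(1)[OF R']]
      have e: "(s R \<otimes> t Q) \<otimes> inv (s R' \<otimes> t Q') \<in> B \<inter> C"
        using eq rcos_eq_iff[OF BC] c by simp
      have "t Q \<otimes> inv t Q' = inv s R \<otimes> ((s R \<otimes> t Q) \<otimes> inv (s R' \<otimes> t Q')) \<otimes> s R'"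
        using c by (simp add: inv_mult_group m_assoc mult_inv_cancel)
      also have "\<dots> \<in> B"
        using e s(2)[OF R] s(2)[OF R'] B
        by (meson IntD1 subgroup.m_closed subgroup.m_inv_closed)
      finally have "B #> t Q = B #> t Q'" using rcos_eq_iff[OF B] c by simp
      then have QQ: "Q = Q'" using t Q Q' by simp
      then have "s R \<otimes> inv s R' \<in> C"
        using e c by (simp add: inv_mult_group m_assoc mult_inv_cancel)
      then have "C #> s R = C #> s R'" using rcos_eq_iff[OF C] c by simp
      then show "Q = Q' \<and> R = R'" using s R R' QQ by simp
    qed
    show "?f ` (rel_cosets G A B \<times> rel_cosets G (A \<inter> B) C) = rel_cosets G A (B \<inter> C)"
    proof (rule subset_antisym; rule subsetI)
      fix Z assume "Z \<in> ?f ` (rel_cosets G A B \<times> rel_cosets G (A \<inter> B) C)"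
      then obtain Q R where "Q \<in> rel_cosets G A B" "R \<in> rel_cosets G (A \<inter> B) C"
        "Z = (B \<inter> C) #> (s R \<otimes> t Q)" by auto
      then show "Z \<in> rel_cosets G A (B \<inter> C)"
        using s t subgroup.m_closed[OF A] by (auto simp: rel_cosets_def)
    next
      fix Z assume "Z \<in> rel_cosets G A (B \<inter> C)"
      then obtain a where a: "a \<in> A" "Z = (B \<inter> C) #> a" by (auto simp: rel_cosets_def)
      define Q where "Q = B #> a"
      have Q: "Q \<in> rel_cosets G A B" using a by (auto simp: Q_def rel_cosets_def)
      define x where "x = a \<otimes> inv t Q"
      have "B #> a = B #> t Q" using t Q by (simp add: Q_def)
      then have xB: "x \<in> B" using rcos_eq_iff[OF B] a t(1)[OF Q] Ac by (simp add: x_def)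
      have xA: "x \<in> A" using a t(1)[OF Q] A
        by (simp add: x_def subgroup.m_closed subgroup.m_inv_closed)
      define R where "R = C #> x"
      have R: "R \<in> rel_cosets G (A \<inter> B) C" using xA xB by (auto simp: R_def rel_cosets_def)
      note c = Ac[OF a(1)] Ac[OF t(1)[OF Q]] Ac[OF s(1)[OF R]] Ac[OF xA]
      have "C #> x = C #> s R" using s R by (simp add: R_def)
      then have "x \<otimes> inv s R \<in> C" using rcos_eq_iff[OF C] c by simp
      moreover have "x \<otimes> inv s R \<in> B"
        using xB s(2)[OF R] B by (simp add: subgroup.m_closed subgroup.m_inv_closed)
      moreover have "a \<otimes> inv (s R \<otimes> t Q) = x \<otimes> inv s R"
        using c by (simp add: x_def inv_mult_group m_assoc)
      ultimately have "(B \<inter> C) #> a = (B \<inter> C) #> (s R \<otimes> t Q)"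
        using rcos_eq_iff[OF BC] c by simp
      then show "Z \<in> ?f ` (rel_cosets G A B \<times> rel_cosets G (A \<inter> B) C)"
        using Q R a by force
    qed
  qed
  then show ?thesis by blast
qed

lemma rel_cosets_nonempty: "subgroup A G \<Longrightarrow> rel_cosets G A B \<noteq> {}"
  using subgroup.one_closed by (fastforce simp: rel_cosets_def)

lemma rel_index_Int:
  assumes "subgroup A G" "subgroup B G" "subgroup C G"
  shows "rel_index G A (B \<inter> C) = rel_index G A B * rel_index G (A \<inter> B) C"
  using rel_cosets_Int_bij[OF assms] bij_betw_same_card
  by (metis card_cartesian_product rel_index_def)

lemma finite_rel_cosets_Int_iff:
  assumes "subgroup A G" "subgroup B G" "subgroup C G"
  shows "finite (rel_cosets G A (B \<inter> C)) \<longleftrightarrow>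
    finite (rel_cosets G A B) \<and> finite (rel_cosets G (A \<inter> B) C)"
  using rel_cosets_Int_bij[OF assms] rel_cosets_nonempty[OF assms(1), of B]
    rel_cosets_nonempty[OF subgroups_Inter_pair[OF assms(1,2)], of C]
  by (metis bij_betw_finite finite_cartesian_product finite_cartesian_productD1
      finite_cartesian_productD2)

lemma rel_cosets_mono: "A' \<subseteq> A \<Longrightarrow> rel_cosets G A' B \<subseteq> rel_cosets G A B"
  by (auto simp: rel_cosets_def)

lemma finite_rel_cosets_mono:
  "A' \<subseteq> A \<Longrightarrow> finite (rel_cosets G A B) \<Longrightarrow> finite (rel_cosets G A' B)"
  by (rule finite_subset[OF rel_cosets_mono])

lemma rel_index_mono:
  "A' \<subseteq> A \<Longrightarrow> finite (rel_cosets G A B) \<Longrightarrow> rel_index G A' B \<le> rel_index G A B"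
  unfolding rel_index_def by (intro card_mono rel_cosets_mono)

lemma rel_index_pos:
  "subgroup A G \<Longrightarrow> finite (rel_cosets G A B) \<Longrightarrow> 0 < rel_index G A B"
  unfolding rel_index_def using rel_cosets_nonempty by (simp add: card_gt_0_iff)

lemma rel_cosets_self:
  assumes "subgroup A G" shows "rel_cosets G A A = {A}"
  using assms subgroup.one_closed[OF assms] subgroup.rcos_const[OF assms is_group]
  by (auto simp: rel_cosets_def)

lemma finite_rel_cosets_Int_self:
  assumes "subgroup A G" "subgroup B G"
  shows "finite (rel_cosets G A (A \<inter> B)) \<longleftrightarrow> finite (rel_cosets G A B)"
  using finite_rel_cosets_Int_iff[OF assms(1,1,2)] by (simp add: rel_cosets_self assms)

lemma finite_rel_cosets_trans:
  assumes S: "subgroup A G" "subgroup B G" "subgroup C G"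
    and fin: "finite (rel_cosets G A B)" "finite (rel_cosets G B C)"
  shows "finite (rel_cosets G A (B \<inter> C))" "finite (rel_cosets G A C)"
proof -
  have "finite (rel_cosets G (A \<inter> B) C)"
    by (rule finite_rel_cosets_mono[OF Int_lower2 fin(2)])
  then show *: "finite (rel_cosets G A (B \<inter> C))"
    using finite_rel_cosets_Int_iff[OF S] fin(1) by simp
  then have "finite (rel_cosets G A (C \<inter> B))" by (simp add: Int_commute)
  then show "finite (rel_cosets G A C)" using finite_rel_cosets_Int_iff[OF S(1,3,2)] by simp
qed

lemma rel_index_trans_le:
  assumes S: "subgroup A G" "subgroup B G" "subgroup C G"
    and fin: "finite (rel_cosets G A B)" "finite (rel_cosets G B C)"
  shows "rel_index G A C \<le> rel_index G A B * rel_index G B C"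
proof -
  have f: "finite (rel_cosets G A (C \<inter> B))"
    using finite_rel_cosets_trans(1)[OF assms] by (simp add: Int_commute)
  then have "0 < rel_index G (A \<inter> C) B"
    using finite_rel_cosets_Int_iff[OF S(1,3,2)] rel_index_pos[OF subgroups_Inter_pair[OF S(1,3)]]
    by simp
  then have "rel_index G A C \<le> rel_index G A (C \<inter> B)" using rel_index_Int[of A C B] S by simp
  also have "\<dots> = rel_index G A B * rel_index G (A \<inter> B) C"
    using rel_index_Int[of A B C] S by (simp add: Int_commute)
  also have "\<dots> \<le> rel_index G A B * rel_index G B C"
    using fin rel_index_mono[of "A \<inter> B" B C] by simp
  finally show ?thesis .
qed

text \<open>
Equal indices mean that every coset of \<open>B\<close> that meets \<open>A\<close> already meets \<open>A'\<close>; together with the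
converse below, this translates between counting and product decompositions.
\<close>

lemma rel_index_eq_factor:
  assumes S: "subgroup A G" "subgroup B G" "subgroup A' G" and "A' \<subseteq> A"
    and fin: "finite (rel_cosets G A B)" and eq: "rel_index G A' B = rel_index G A B"
    and x: "x \<in> A"
  shows "\<exists>b\<in>A \<inter> B. \<exists>a\<in>A'. x = b \<otimes> a"
proof -
  have "rel_cosets G A' B = rel_cosets G A B"
    using card_subset_eq[OF fin rel_cosets_mono[OF \<open>A' \<subseteq> A\<close>]] eq by (simp add: rel_index_def)
  then have "B #> x \<in> rel_cosets G A' B" using x by (auto simp: rel_cosets_def)
  then obtain a where a: "a \<in> A'" "B #> x = B #> a" by (auto simp: rel_cosets_def)
  have c: "x \<in> carrier G" "a \<in> carrier G" 
    using subgroup.mem_carrier[OF S(1) x] subgroup.mem_carrier[OF S(3) a(1)] by auto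
  have "x \<otimes> inv a \<in> B" using a rcos_eq_iff[OF S(2) c] by simp
  moreover have "x \<otimes> inv a \<in> A"
    using x a \<open>A' \<subseteq> A\<close> S(1) by (simp add: subgroup.m_closed subgroup.m_inv_closed subset_iff)
  moreover have "x = (x \<otimes> inv a) \<otimes> a" using c by (simp add: m_assoc)
  ultimately show ?thesis using a by blast
qed

lemma rel_index_factor_eq:
  assumes S: "subgroup A G" "subgroup B G" and "A' \<subseteq> A"
    and f: "\<And>x. x \<in> A \<Longrightarrow> \<exists>b\<in>B. \<exists>a\<in>A'. x = b \<otimes> a"
  shows "rel_index G A' B = rel_index G A B"
proof -
  have "B #> x \<in> rel_cosets G A' B" if x: "x \<in> A" for x
  proof -
    obtain b a where ba: "b \<in> B" "a \<in> A'" "x = b \<otimes> a" using f[OF x] by blast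
    have c: "a \<in> carrier G" "b \<in> carrier G"
      using ba \<open>A' \<subseteq> A\<close> subgroup.mem_carrier[OF S(1)] subgroup.mem_carrier[OF S(2)] by auto
    then have "x \<otimes> inv a \<in> B" using ba by (simp add: m_assoc)
    then have "B #> x = B #> a" using rcos_eq_iff[OF S(2)] ba c by simp
    then show ?thesis using ba by (auto simp: rel_cosets_def)
  qed
  then have "rel_cosets G A' B = rel_cosets G A B"
    using \<open>A' \<subseteq> A\<close> by (auto simp: rel_cosets_def)
  then show ?thesis by (simp add: rel_index_def)
qed

section \<open>Conjugates\<close>

lemma mem_conjugate:
  assumes "k \<in> carrier G" "H \<subseteq> carrier G"
  shows "x \<in> conjugate G k H \<longleftrightarrow> x \<in> carrier G \<and> inv k \<otimes> x \<otimes> k \<in> H"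
proof
  assume "x \<in> conjugate G k H"
  then obtain h where h: "h \<in> H" "x = k \<otimes> h \<otimes> inv k"
    by (auto simp: conjugate_def l_coset_def r_coset_def)
  then have "h \<in> carrier G" using assms by blast
  then show "x \<in> carrier G \<and> inv k \<otimes> x \<otimes> k \<in> H"
    using h assms by (simp add: m_assoc mult_inv_cancel)
next
  assume x: "x \<in> carrier G \<and> inv k \<otimes> x \<otimes> k \<in> H"
  then have "x = k \<otimes> (inv k \<otimes> x \<otimes> k) \<otimes> inv k"
    using assms by (simp add: m_assoc mult_inv_cancel)
  then show "x \<in> conjugate G k H"
    using x by (auto simp: conjugate_def l_coset_def r_coset_def)
qed

lemma conjugate_subset: "k \<in> carrier G \<Longrightarrow> H \<subseteq> carrier G \<Longrightarrow> conjugate G k H \<subseteq> carrier G"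
  using mem_conjugate by blast

lemma conjugate_mult:
  assumes "k \<in> carrier G" "l \<in> carrier G" "H \<subseteq> carrier G"
  shows "conjugate G k (conjugate G l H) = conjugate G (k \<otimes> l) H"
  using assms by (auto simp: mem_conjugate conjugate_subset inv_mult_group m_assoc)

lemma conjugate_one: "H \<subseteq> carrier G \<Longrightarrow> conjugate G \<one> H = H"
  by (auto simp: mem_conjugate subset_iff)

lemma subgroup_conjugate:
  assumes k: "k \<in> carrier G" and H: "subgroup H G"
  shows "subgroup (conjugate G k H) G"
proof (rule subgroupI)
  have Hc: "H \<subseteq> carrier G" using H by (rule subgroup.subset)
  show "conjugate G k H \<subseteq> carrier G" using conjugate_subset[OF k Hc] .
  show "conjugate G k H \<noteq> {}"
    using mem_conjugate[OF k Hc, of \<one>] subgroup.one_closed[OF H] k by auto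
  fix a assume "a \<in> conjugate G k H"
  then have a: "a \<in> carrier G" "inv k \<otimes> a \<otimes> k \<in> H" using mem_conjugate[OF k Hc] by auto
  have "inv k \<otimes> inv a \<otimes> k = inv (inv k \<otimes> a \<otimes> k)"
    using a k by (simp add: inv_mult_group m_assoc)
  then show "inv a \<in> conjugate G k H"
    using a mem_conjugate[OF k Hc] subgroup.m_inv_closed[OF H a(2)] by simp
  fix b assume "b \<in> conjugate G k H"
  then have b: "b \<in> carrier G" "inv k \<otimes> b \<otimes> k \<in> H" using mem_conjugate[OF k Hc] by auto
  have "inv k \<otimes> (a \<otimes> b) \<otimes> k = (inv k \<otimes> a \<otimes> k) \<otimes> (inv k \<otimes> b \<otimes> k)"
    using a b k by (simp add: m_assoc mult_inv_cancel)
  then show "a \<otimes> b \<in> conjugate G k H"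
    using a b mem_conjugate[OF k Hc] subgroup.m_closed[OF H a(2) b(2)] by simp
qed

lemma rel_cosets_conjugate_bij:
  assumes k: "k \<in> carrier G" and A: "subgroup A G" and B: "subgroup B G"
  shows "bij_betw (conjugate G k) (rel_cosets G A B)
    (rel_cosets G (conjugate G k A) (conjugate G k B))"
proof (rule bij_betw_imageI)
  have Ac: "A \<subseteq> carrier G" "B \<subseteq> carrier G" using A B subgroup.subset by blast+
  have sub: "Q \<subseteq> carrier G" if "Q \<in> rel_cosets G A B" for Q
    using that Ac by (auto simp: rel_cosets_def r_coset_def)
  show "inj_on (conjugate G k) (rel_cosets G A B)"
  proof (rule inj_on_inverseI)
    fix Q assume "Q \<in> rel_cosets G A B"
    then show "conjugate G (inv k) (conjugate G k Q) = Q"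
      using sub k by (simp add: conjugate_mult conjugate_one)
  qed
  have c: "conjugate G k (B #> a) = conjugate G k B #> (k \<otimes> a \<otimes> inv k)" if a: "a \<in> carrier G" for a
  proof -
    have "k \<otimes> (b \<otimes> a) \<otimes> inv k = (k \<otimes> b \<otimes> inv k) \<otimes> (k \<otimes> a \<otimes> inv k)" if "b \<in> B" for b
    proof -
      have "b \<in> carrier G" using that Ac by blast
      then show ?thesis using a k by (simp add: m_assoc mult_inv_cancel)
    qed
    then show ?thesis by (auto simp: conjugate_def l_coset_def r_coset_def)
  qed
  have "conjugate G k A = (\<lambda>a. k \<otimes> a \<otimes> inv k) ` A"
    by (auto simp: conjugate_def l_coset_def r_coset_def)
  then show "conjugate G k ` rel_cosets G A B =
      rel_cosets G (conjugate G k A) (conjugate G k B)"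
    using c Ac by (auto simp: rel_cosets_def image_image subset_iff intro!: image_cong)
qed

lemma rel_index_conjugate:
  assumes "k \<in> carrier G" "subgroup A G" "subgroup B G"
  shows "rel_index G (conjugate G k A) (conjugate G k B) = rel_index G A B"
  using rel_cosets_conjugate_bij[OF assms] bij_betw_same_card unfolding rel_index_def by metis

lemma finite_rel_cosets_conjugate_iff:
  assumes "k \<in> carrier G" "subgroup A G" "subgroup B G"
  shows "finite (rel_cosets G (conjugate G k A) (conjugate G k B)) \<longleftrightarrow> finite (rel_cosets G A B)"
  using rel_cosets_conjugate_bij[OF assms] bij_betw_finite by blast

section \<open>Commensurators\<close>

lemma finite_index_iff_rel_cosets: "finite_index G A B \<longleftrightarrow> finite (rel_cosets G A B)"
  by (simp add: finite_index_def rel_cosets_def RCOSETS_def r_coset_def UNION_singleton_eq_range)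

lemma mem_commensurator:
  assumes H: "subgroup H G"
  shows "k \<in> commensurator G H \<longleftrightarrow> k \<in> carrier G \<and>
    finite (rel_cosets G H (conjugate G k H)) \<and> finite (rel_cosets G (conjugate G k H) H)"
proof (cases "k \<in> carrier G")
  case True
  note S = subgroup_conjugate[OF True H]
  show ?thesis
    using True finite_rel_cosets_Int_self[OF H S] finite_rel_cosets_Int_self[OF S H]
    by (simp add: commensurator_def finite_index_iff_rel_cosets Int_commute)
qed (simp add: commensurator_def)

lemma subgroup_commensurator:
  assumes H: "subgroup H G"
  shows "subgroup (commensurator G H) G"
proof (rule subgroupI)
  have Hc: "H \<subseteq> carrier G" using H by (rule subgroup.subset)
  show "commensurator G H \<subseteq> carrier G" by (auto simp: commensurator_def)
  have "\<one> \<in> commensurator G H"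
    using H by (simp add: mem_commensurator conjugate_one Hc rel_cosets_self)
  then show "commensurator G H \<noteq> {}" by blast
  fix k assume k: "k \<in> commensurator G H"
  then have kc: "k \<in> carrier G" by (simp add: commensurator_def)
  have e: "conjugate G (inv k) (conjugate G k H) = H"
    using kc Hc by (simp add: conjugate_mult conjugate_one)
  show "inv k \<in> commensurator G H"
    using k kc H finite_rel_cosets_conjugate_iff[of "inv k" H "conjugate G k H"]
      finite_rel_cosets_conjugate_iff[of "inv k" "conjugate G k H" H]
    by (simp add: mem_commensurator e subgroup_conjugate)
  fix l assume l: "l \<in> commensurator G H"
  then have lc: "l \<in> carrier G" by (simp add: commensurator_def)
  have e': "conjugate G k (conjugate G l H) = conjugate G (k \<otimes> l) H"
    using kc lc Hc by (simp add: conjugate_mult)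
  have f: "finite (rel_cosets G (conjugate G k H) (conjugate G (k \<otimes> l) H))"
    "finite (rel_cosets G (conjugate G (k \<otimes> l) H) (conjugate G k H))"
    using l lc kc H finite_rel_cosets_conjugate_iff[of k H "conjugate G l H"]
      finite_rel_cosets_conjugate_iff[of k "conjugate G l H" H]
    by (simp_all add: mem_commensurator e' subgroup_conjugate)
  note C = subgroup_conjugate[OF kc H] subgroup_conjugate[OF m_closed[OF kc lc] H]
  show "k \<otimes> l \<in> commensurator G H"
    using finite_rel_cosets_trans(2)[OF H C _ f(1)] finite_rel_cosets_trans(2)[OF C(2,1) H f(2)]
      k kc lc H by (simp add: mem_commensurator)
qed

end

section \<open>Growth of the index of iterated conjugates\<close>

text \<open>
The setting of the dichotomy. The group \<open>V i\<close> below is the \<open>i\<close>-th conjugate of \<open>H\<close>, and a window is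
the intersection of the conjugates over an interval; conjugation by \<open>\<phi>\<close> shifts windows.
\<close>

locale commensurating_element = group G for G (structure) +
  fixes H and \<phi>
  assumes subgroup_H: "subgroup H G" and comm: "\<phi> \<in> commensurator G H"
begin

lemma \<phi>_closed: "\<phi> \<in> carrier G"
  using comm by (simp add: commensurator_def)

lemma H_sub: "H \<subseteq> carrier G"
  using subgroup_H by (rule subgroup.subset)

abbreviation V :: "int \<Rightarrow> 'a set" where
  "V i \<equiv> conjugate G (\<phi> [^] i) H"

definition window :: "int \<Rightarrow> int \<Rightarrow> 'a set" where
  "window a b = (\<Inter>i\<in>{a..b}. V i)"

lemma subgroup_V: "subgroup (V i) G"
  by (simp add: subgroup_conjugate \<phi>_closed subgroup_H)

lemma subgroup_window: "a \<le> b \<Longrightarrow> subgroup (window a b) G"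
  unfolding window_def by (rule subgroups_Inter) (auto simp: subgroup_V)

lemma window_antimono: "a' \<le> a \<Longrightarrow> b \<le> b' \<Longrightarrow> window a' b' \<subseteq> window a b"
  by (auto simp: window_def)

lemma window_Int:
  assumes "a \<le> c" "c \<le> b + 1" "b \<le> d"
  shows "window a b \<inter> window c d = window a d"
proof -
  have "{a..b} \<union> {c..d} = {a..d}" using assms by auto
  then show ?thesis unfolding window_def by (metis INT_Un)
qed

lemma window_single: "window a a = V a"
  by (simp add: window_def)

lemma conjugate_window:
  assumes "a \<le> b"
  shows "conjugate G (\<phi> [^] t) (window a b) = window (a + t) (b + t)"
proof -
  let ?c = "\<lambda>x. \<phi> [^] t \<otimes> x \<otimes> inv (\<phi> [^] t)"
  have im: "conjugate G (\<phi> [^] t) X = ?c ` X" for X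
    by (auto simp: conjugate_def l_coset_def r_coset_def)
  have V: "?c ` V i = V (i + t)" for i
    using conjugate_mult[of "\<phi> [^] t" "\<phi> [^] i" H] \<phi>_closed H_sub
    by (simp add: im[symmetric] int_pow_mult add.commute[of i t])
  have inj: "inj_on ?c (carrier G)"
    using \<phi>_closed by (intro inj_onI) simp
  have "conjugate G (\<phi> [^] t) (window a b) = (\<Inter>i\<in>{a..b}. ?c ` V i)"
    unfolding im window_def
    by (rule image_INT[OF inj, of _ _ a]) (use assms subgroup.subset[OF subgroup_V] in auto)
  also have "\<dots> = (\<Inter>i\<in>(\<lambda>i. i + t) ` {a..b}. V i)"
    by (simp only: V image_image)
  also have "\<dots> = window (a + t) (b + t)" by (simp add: window_def)
  finally show ?thesis .
qed

lemma rel_index_shift: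
  assumes "a \<le> b" "c \<le> d" "a' = a + t" "b' = b + t" "c' = c + t" "d' = d + t"
  shows "rel_index G (window a' b') (window c' d') = rel_index G (window a b) (window c d)"
  using assms by (simp add: conjugate_window[symmetric] rel_index_conjugate subgroup_window \<phi>_closed)

lemma finite_V: "finite (rel_cosets G (V i) (V j))"
proof -
  have "\<phi> [^] (j - i) \<in> commensurator G H"
    by (rule subgroup_int_pow_closed[OF subgroup_commensurator[OF subgroup_H] comm])
  then have "finite (rel_cosets G H (V (j - i)))" using mem_commensurator[OF subgroup_H] by simp
  then have "finite (rel_cosets G (V i) (conjugate G (\<phi> [^] i) (V (j - i))))"
    using finite_rel_cosets_conjugate_iff[OF _ subgroup_H subgroup_V] \<phi>_closed by simp
  then show ?thesis
    using \<phi>_closed H_sub by (simp add: conjugate_mult int_pow_mult[symmetric])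
qed

lemma finite_window:
  assumes "a \<le> b" "c \<le> d"
  shows "finite (rel_cosets G (window a b) (window c d))"
proof -
  have "finite (rel_cosets G (V a) (window c (c + int n)))" for n
  proof (induction n)
    case (Suc n)
    have "finite (rel_cosets G (window c (c + int n)) (V (c + int n + 1)))"
      by (rule finite_rel_cosets_mono[OF _ finite_V[of c]])
        (use window_antimono[of c c c "c + int n"] in \<open>simp add: window_single\<close>)
    then have "finite (rel_cosets G (V a) (window c (c + int n) \<inter> V (c + int n + 1)))"
      using finite_rel_cosets_trans(1)[OF subgroup_V subgroup_window subgroup_V Suc] by simp
    then show ?case using window_Int[of c "c + int n + 1" "c + int n" "c + int n + 1"]
      by (simp add: window_single add_ac)
  qed (simp add: finite_V window_single)
  from this[of "nat (d - c)"] have "finite (rel_cosets G (V a) (window c d))" using assms by simp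
  then show ?thesis
    by (rule finite_rel_cosets_mono[rotated])
      (use window_antimono[of a a a b] assms in \<open>simp add: window_single\<close>)
qed

definition step_index :: "nat \<Rightarrow> nat" where
  "step_index k = rel_index G (window 0 (int k)) (V (int k + 1))"

lemma step_index_shift:
  assumes "a \<le> b"
  shows "rel_index G (window a b) (V (b + 1)) = step_index (nat (b - a))"
  unfolding step_index_def window_single[symmetric]
  by (rule rel_index_shift[where t = a]) (use assms in auto)

text \<open>
After a shift, the two indices concern the same conjugate, and the longer window is the smaller
group.
\<close>

lemma step_index_antimono: "step_index (Suc k) \<le> step_index k"
proof -
  have "step_index (Suc k) \<le> rel_index G (window 1 (int k + 1)) (V (int k + 2))"
    unfolding step_index_def
    using rel_index_mono[OF window_antimono finite_window[of 1 "int k + 1" "int k + 2" "int k + 2"],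
        of 0 "int k + 1"] by (simp add: window_single add_ac)
  also have "\<dots> = step_index k" using step_index_shift[of 1 "int k + 1"] by (simp add: add_ac)
  finally show ?thesis .
qed

text \<open>
A length of windows from which on the index of the next step is constant; windows of this length
are the tidy subgroups of the argument.
\<close>

definition width :: nat where
  "width = (SOME m. \<forall>k\<ge>m. step_index k = step_index m)"

lemma step_index_const:
  assumes "k \<ge> width" shows "step_index k = step_index width"
proof -
  have "\<exists>m. \<forall>k\<ge>m. step_index k = step_index m"
  proof -
    obtain m where m: "\<And>k. step_index m \<le> step_index k"
      using ex_has_least_nat[of "\<lambda>_. True" 0 step_index] by auto
    have "step_index k = step_index m" if "k \<ge> m" for k
      using lift_Suc_antimono_le[of step_index m k] step_index_antimono m[of k] that
      by (simp add: le_antisym)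
    then show ?thesis by blast
  qed
  from someI_ex[OF this] have "\<forall>k\<ge>width. step_index k = step_index width"
    by (fold width_def)
  then show ?thesis using assms by blast
qed

text \<open>
Extending the window \<open>[a, b]\<close> to the left does not change the index by which adding \<open>b + 1\<close> on the
right makes it drop. So the subgroup for \<open>[a', b]\<close> meets all cosets of \<open>V (b + 1)\<close> that the one for
\<open>[a, b]\<close> meets.
\<close>

lemma window_factor_step:
  assumes x: "x \<in> window a b" and ab: "int width \<le> b - a" and a': "a' \<le> a"
  shows "\<exists>y\<in>window a (b + 1). \<exists>z\<in>window a' b. x = y \<otimes> z"
proof -
  have le: "a \<le> b" using ab by linarith
  have "rel_index G (window a' b) (V (b + 1)) = rel_index G (window a b) (V (b + 1))"
    using step_index_shift[of a b] step_index_shift[of a' b] le a' ab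
      step_index_const[of "nat (b - a)"] step_index_const[of "nat (b - a')"] by simp
  then obtain y z where yz: "y \<in> window a b \<inter> V (b + 1)" "z \<in> window a' b" "x = y \<otimes> z"
    using rel_index_eq_factor[OF subgroup_window subgroup_V subgroup_window window_antimono
        _ _ x, of a' b "b + 1"] finite_window[of a b "b + 1" "b + 1"] le a'
    by (auto simp: window_single)
  moreover have "window a b \<inter> V (b + 1) = window a (b + 1)"
    using window_Int[of a "b + 1" b "b + 1"] le by (simp add: window_single)
  ultimately show ?thesis by metis
qed

lemma window_factor:
  assumes x: "x \<in> window a b" and ab: "int width \<le> b - a" and a': "a' \<le> a" and b': "b \<le> b'"
  shows "\<exists>y\<in>window a b'. \<exists>z\<in>window a' b. x = y \<otimes> z"
proof -
  have le: "a \<le> b" using ab by linarith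
  have "\<exists>y\<in>window a (b + int j). \<exists>z\<in>window a' b. x = y \<otimes> z" for j
  proof (induction j)
    case 0
    show ?case using x subgroup.mem_carrier[OF subgroup_window[OF le] x]
        subgroup.one_closed[OF subgroup_window[of a' b]] le a'
      by (intro bexI[of _ x] bexI[of _ \<one>]) auto
  next
    case (Suc j)
    then obtain y z where yz: "y \<in> window a (b + int j)" "z \<in> window a' b" "x = y \<otimes> z" by blast
    obtain y' z' where yz': "y' \<in> window a (b + int j + 1)" "z' \<in> window a' (b + int j)"
      "y = y' \<otimes> z'"
      using window_factor_step[OF yz(1) _ a'] ab by auto
    have z': "z' \<in> window a' b" using yz'(2) window_antimono[of a' a' b "b + int j"] by auto
    have S: "subgroup (window a' b) G" "subgroup (window a (b + int j + 1)) G"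
      using le a' by (auto intro!: subgroup_window)
    have "z' \<otimes> z \<in> window a' b" using subgroup.m_closed[OF S(1) z' yz(2)] .
    moreover have "x = y' \<otimes> (z' \<otimes> z)"
      using yz yz' z' subgroup.mem_carrier[OF S(1)] subgroup.mem_carrier[OF S(2)]
      by (simp add: m_assoc)
    ultimately show ?case using yz'(1) by (auto simp: add_ac)
  qed
  from this[of "nat (b' - b)"] show ?thesis using b' by simp
qed

definition U :: "int \<Rightarrow> 'a set" where
  "U i = window i (i + int width)"

lemma subgroup_U: "subgroup (U i) G"
  by (simp add: U_def subgroup_window)

lemma finite_U: "finite (rel_cosets G (U i) (U j))"
  by (simp add: U_def finite_window)

lemma conjugate_U: "conjugate G (\<phi> [^] t) (U i) = U (i + t)"
  by (simp add: U_def conjugate_window add_ac)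

lemma rel_index_U_shift: "rel_index G (U (i + t)) (U (j + t)) = rel_index G (U i) (U j)"
  by (simp add: conjugate_U[symmetric] rel_index_conjugate subgroup_U \<phi>_closed)

text \<open>
In the graph of cosets, \<open>index_seq n\<close> is the number of vertices reached in \<open>n\<close> steps, and
\<open>branch_seq n\<close> the number of first edges of the paths from \<open>U 0\<close> to \<open>U n\<close>. The number of edges
leaving a vertex is \<open>index_seq 1\<close>.
\<close>

definition index_seq :: "nat \<Rightarrow> nat" where
  "index_seq n = rel_index G (U 0) (U (int n))"

definition branch_seq :: "nat \<Rightarrow> nat" where
  "branch_seq n = rel_index G (U 0 \<inter> U (int n)) (U 1)"

lemma index_seq_0: "index_seq 0 = 1"
  by (simp add: index_seq_def rel_index_def rel_cosets_self subgroup_U)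

text \<open>
Both sides count the pairs of an edge leaving \<open>U 0\<close> and a vertex reached from the end of that edge in
\<open>n\<close> further steps; in terms of indices, both are equal to \<open>[U 0 : U 0 \<inter> U 1 \<inter> U (n + 1)]\<close>. That
\<open>U 0 \<inter> U 1\<close> reaches as many cosets of \<open>U (n + 1)\<close> as \<open>U 1\<close> does is the concatenation of paths,
that is, \<open>window_factor\<close>.
\<close>

lemma index_seq_rec: "index_seq (Suc n) * branch_seq (Suc n) = index_seq 1 * index_seq n"
proof -
  let ?k = "int (Suc n)"
  have U01: "U 0 \<inter> U 1 = window 0 (1 + int width)"
    unfolding U_def using window_Int[of 0 1 "int width" "1 + int width"] by simp
  have "index_seq (Suc n) * branch_seq (Suc n) = rel_index G (U 0) (U 1 \<inter> U ?k)"
    unfolding index_seq_def branch_seq_def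
    using rel_index_Int[OF subgroup_U[of 0] subgroup_U[of ?k] subgroup_U[of 1]]
    by (simp add: Int_commute)
  also have "\<dots> = index_seq 1 * rel_index G (U 0 \<inter> U 1) (U ?k)"
    unfolding index_seq_def
    using rel_index_Int[OF subgroup_U[of 0] subgroup_U[of 1] subgroup_U[of ?k]] by simp
  also have "rel_index G (U 0 \<inter> U 1) (U ?k) = rel_index G (U 1) (U ?k)"
  proof (rule rel_index_factor_eq[OF subgroup_U subgroup_U Int_lower2])
    fix x assume "x \<in> U 1"
    then obtain y z where "y \<in> window 1 (?k + int width)" "z \<in> window 0 (1 + int width)"
      "x = y \<otimes> z"
      using window_factor[of x 1 "1 + int width" 0 "?k + int width"] by (auto simp: U_def)
    then show "\<exists>y\<in>U ?k. \<exists>z\<in>U 0 \<inter> U 1. x = y \<otimes> z"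
      unfolding U01 using window_antimono[of 1 ?k "?k + int width" "?k + int width"]
      by (auto simp: U_def)
  qed
  also have "\<dots> = index_seq n"
    unfolding index_seq_def using rel_index_U_shift[of 0 1 "int n"] by (simp add: add_ac)
  finally show ?thesis .
qed

text \<open>
A first edge of a path from \<open>U 0\<close> to \<open>U n\<close> is also one of a path to \<open>U (n + 1)\<close>, since the path can
be continued. Algebraically, an element of \<open>U 0 \<inter> U n\<close> is corrected by a factor in
\<open>U 0 \<inter> \<dots> \<inter> U n\<close>, which leaves its coset of \<open>U 1\<close> unchanged.
\<close>

lemma branch_seq_mono: "branch_seq (Suc n) \<le> branch_seq (Suc (Suc n))"
proof -
  let ?k = "int (Suc n)"
  have "rel_cosets G (U 0 \<inter> U ?k) (U 1) \<subseteq> rel_cosets G (U 0 \<inter> U (?k + 1)) (U 1)"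
  proof
    fix Q assume "Q \<in> rel_cosets G (U 0 \<inter> U ?k) (U 1)"
    then obtain x where x: "x \<in> U 0" "x \<in> U ?k" "Q = U 1 #> x" by (auto simp: rel_cosets_def)
    note c = subgroup.mem_carrier[OF subgroup_U]
    \<comment> \<open>The inverse is factorised because the correction has to be on the left of \<open>x\<close>.\<close>
    have "inv x \<in> window ?k (?k + int width)"
      using subgroup.m_inv_closed[OF subgroup_U x(2)] by (simp add: U_def)
    then obtain y z where yz: "y \<in> window ?k (?k + int width + 1)" "z \<in> window 0 (?k + int width)"
      "inv x = y \<otimes> z"
      using window_factor[of "inv x" ?k "?k + int width" 0 "?k + int width + 1"] by auto
    have z: "z \<in> U 0" "z \<in> U 1" and y: "y \<in> U (?k + 1)"
      using yz window_antimono[of 0 0 "int width" "?k + int width"]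
        window_antimono[of 0 1 "1 + int width" "?k + int width"]
        window_antimono[of ?k "?k + 1" "?k + 1 + int width" "?k + int width + 1"]
      by (auto simp: U_def add_ac)
    note c' = c[OF x(1)] c[OF y] c[OF z(1)]
    have xe: "x = inv z \<otimes> inv y" using yz(3) c' by (metis inv_inv inv_mult_group)
    then have "inv y = z \<otimes> x" using c' by (simp add: mult_inv_cancel)
    then have "inv y \<in> U 0" using subgroup.m_closed[OF subgroup_U z(1) x(1)] by simp
    moreover have "inv y \<in> U (?k + 1)" using subgroup.m_inv_closed[OF subgroup_U y] .
    moreover have "U 1 #> x = U 1 #> inv y"
      using rcos_eq_iff[OF subgroup_U, of x "inv y"] subgroup.m_inv_closed[OF subgroup_U z(2)] c' xe
      by (simp add: m_assoc)
    ultimately show "Q \<in> rel_cosets G (U 0 \<inter> U (?k + 1)) (U 1)"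
      using x(3) by (auto simp: rel_cosets_def)
  qed
  moreover have "finite (rel_cosets G (U 0 \<inter> U (?k + 1)) (U 1))"
    by (rule finite_rel_cosets_mono[OF Int_lower1 finite_U])
  ultimately show ?thesis
    unfolding branch_seq_def rel_index_def by (auto intro: card_mono simp: add_ac)
qed

lemma branch_seq_le: "branch_seq n \<le> index_seq 1"
  unfolding branch_seq_def index_seq_def using rel_index_mono[OF Int_lower1 finite_U] by simp

lemma branch_seq_pos: "0 < branch_seq n"
proof -
  have "finite (rel_cosets G (U 0 \<inter> U (int n)) (U 1))"
    by (rule finite_rel_cosets_mono[OF Int_lower1 finite_U])
  then show ?thesis
    unfolding branch_seq_def by (intro rel_index_pos subgroups_Inter_pair subgroup_U)
qed

lemma index_seq_mono: "index_seq n \<le> index_seq (Suc n)"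
proof -
  have "index_seq n * branch_seq (Suc n) \<le> index_seq 1 * index_seq n"
    using branch_seq_le by (simp add: mult.commute)
  then have "index_seq n * branch_seq (Suc n) \<le> index_seq (Suc n) * branch_seq (Suc n)"
    by (simp add: index_seq_rec)
  then show ?thesis using branch_seq_pos[of "Suc n"] by simp
qed

text \<open>
By the recursion, \<open>index_seq\<close> is multiplied in each step by \<open>c / branch_seq\<close> with
\<open>c = index_seq 1\<close>. This factor does not increase; it is eventually \<open>1\<close>, or always at least
\<open>c / (c - 1)\<close>.
\<close>

lemma index_seq_dichotomy:
  "(\<exists>M. \<forall>n. index_seq n \<le> M) \<or> (\<exists>r>1. \<forall>n. r ^ n \<le> real (index_seq n))"
proof (cases "\<exists>p. branch_seq (Suc p) = index_seq 1")
  case True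
  then obtain p where p: "branch_seq (Suc p) = index_seq 1" by blast
  have b: "branch_seq (Suc n) = index_seq 1" if "n \<ge> p" for n
    using lift_Suc_mono_le[of "\<lambda>n. branch_seq (Suc n)" p n] branch_seq_mono p branch_seq_le that
    by (metis le_antisym)
  have "index_seq n \<le> index_seq p" for n
  proof (cases "n \<le> p")
    case True
    then show ?thesis using lift_Suc_mono_le[of index_seq n p] index_seq_mono by blast
  next
    case False
    then have "p \<le> n" by simp
    then show ?thesis
    proof (induction n rule: dec_induct)
      case (step n)
      then have "index_seq (Suc n) * index_seq 1 = index_seq 1 * index_seq n"
        using index_seq_rec[of n] b by simp
      then have "index_seq (Suc n) = index_seq n"
        using branch_seq_pos[of "Suc p"] p by simp
      then show ?case using step by simp
    qed simp
  qed
  then show ?thesis by blast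
next
  case False
  let ?c = "index_seq 1"
  have lt: "branch_seq (Suc n) + 1 \<le> ?c" for n
    using False branch_seq_le[of "Suc n"] by (metis Suc_eq_plus1 Suc_leI le_neq_implies_less)
  then have c: "2 \<le> ?c" using branch_seq_pos[of "Suc 0"] by (metis add_le_mono1 le_trans one_add_one Suc_leI One_nat_def)
  define r where "r = real ?c / (real ?c - 1)"
  have r: "r > 1" using c by (simp add: r_def)
  have "r ^ n \<le> real (index_seq n)" for n
  proof (induction n)
    case (Suc n)
    have "real ?c * real (index_seq n) = real (index_seq (Suc n)) * real (branch_seq (Suc n))"
      using index_seq_rec[of n] by (metis of_nat_mult)
    also have "\<dots> \<le> real (index_seq (Suc n)) * (real ?c - 1)"
      using lt[of n] by (intro mult_left_mono) auto
    finally have "r * real (index_seq n) \<le> real (index_seq (Suc n))"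
      using c by (simp add: r_def field_simps)
    moreover have "r * r ^ n \<le> r * real (index_seq n)" using Suc r by simp
    ultimately show ?case by simp
  qed (simp add: index_seq_0)
  then show ?thesis using r by blast
qed

end

theorem (in group) conjugate_index_dichotomy:
  assumes "subgroup H G" "\<phi> \<in> commensurator G H"
  obtains U where "subgroup U G" "U \<subseteq> H" "finite (rel_cosets G H U)"
    "(\<exists>M. \<forall>n::nat. rel_index G U (conjugate G (\<phi> [^] n) U) \<le> M) \<or>
     (\<exists>r>1. \<forall>n::nat. r ^ n \<le> real (rel_index G U (conjugate G (\<phi> [^] n) U)))"
proof -
  interpret commensurating_element G H \<phi>
    by (intro commensurating_element.intro commensurating_element_axioms.intro is_group assms)
  have "U 0 \<subseteq> H" using window_antimono[of 0 0 0 "int width"] by (simp add: U_def window_single conjugate_one H_sub)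
  moreover have "finite (rel_cosets G H (U 0))"
    using finite_window[of 0 0 0 "int width"] by (simp add: U_def window_single conjugate_one H_sub)
  moreover have "conjugate G (\<phi> [^] n) (U 0) = U (int n)" for n :: nat
    using conjugate_U[of "int n" 0] by (simp add: int_pow_int)
  ultimately show thesis
    using that[OF subgroup_U[of 0]] index_seq_dichotomy by (simp add: index_seq_def)
qed

section \<open>Word lengths and distortion of cyclic subgroups\<close>

context group
begin

lemma set_inv_subset: "S \<subseteq> carrier G \<Longrightarrow> S \<union> set_inv S \<subseteq> carrier G"
  by (auto simp: SET_INV_def)

lemma foldr_mult_closed: "set ws \<subseteq> carrier G \<Longrightarrow> foldr (\<otimes>) ws \<one> \<in> carrier G"
  by (induction ws) auto

lemma foldr_mult_append:
  assumes "A \<subseteq> carrier G" "set xs \<subseteq> A" "set ys \<subseteq> A"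
  shows "foldr (\<otimes>) (xs @ ys) \<one> = foldr (\<otimes>) xs \<one> \<otimes> foldr (\<otimes>) ys \<one>"
proof -
  have ys: "set ys \<subseteq> carrier G" and "set xs \<subseteq> carrier G" using assms by auto
  from this(2) show ?thesis
    by (induction xs) (use foldr_mult_closed ys in \<open>simp_all add: m_assoc\<close>)
qed

lemma generate_word:
  assumes S: "S \<subseteq> carrier G" and "g \<in> generate G S"
  shows "\<exists>ws. set ws \<subseteq> S \<union> set_inv S \<and> foldr (\<otimes>) ws \<one> = g"
  using assms(2)
proof induction
  case one
  show ?case by (intro exI[of _ "[]"]) simp
next
  case (incl h)
  then show ?case using S by (intro exI[of _ "[h]"]) auto
next
  case (inv h)
  then show ?case using S by (intro exI[of _ "[inv h]"]) (auto simp: SET_INV_def)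
next
  case (eng g h)
  then obtain xs ys where xs: "set xs \<subseteq> S \<union> set_inv S" "foldr (\<otimes>) xs \<one> = g"
    and ys: "set ys \<subseteq> S \<union> set_inv S" "foldr (\<otimes>) ys \<one> = h" by auto
  then have "foldr (\<otimes>) (xs @ ys) \<one> = g \<otimes> h"
    using foldr_mult_append[OF set_inv_subset[OF S] xs(1) ys(1)] by simp
  then show ?case using xs ys by (intro exI[of _ "xs @ ys"]) simp
qed

lemma word_length_le:
  "set ws \<subseteq> S \<union> set_inv S \<Longrightarrow> foldr (\<otimes>) ws \<one> = g \<Longrightarrow> word_length G S g \<le> length ws"
  unfolding word_length_def by (intro Least_le) auto

lemma word_length_witness:
  assumes "generates G S" "g \<in> carrier G"
  obtains ws where "length ws = word_length G S g" "set ws \<subseteq> S \<union> set_inv S"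
    "foldr (\<otimes>) ws \<one> = g"
proof -
  have "\<exists>n ws. length ws = n \<and> set ws \<subseteq> S \<union> set_inv S \<and> foldr (\<otimes>) ws \<one> = g"
    using generate_word[of S g] assms by (auto simp: generates_def)
  from LeastI_ex[OF this] show thesis using that unfolding word_length_def by blast
qed

lemma word_length_one: "word_length G S \<one> = 0"
  using word_length_le[of "[]" S \<one>] by simp

lemma word_length_mult:
  assumes S: "generates G S" and g: "g \<in> carrier G" and h: "h \<in> carrier G"
  shows "word_length G S (g \<otimes> h) \<le> word_length G S g + word_length G S h"
proof -
  obtain xs where xs: "length xs = word_length G S g" "set xs \<subseteq> S \<union> set_inv S"
    "foldr (\<otimes>) xs \<one> = g" using word_length_witness[OF S g] .
  obtain ys where ys: "length ys = word_length G S h" "set ys \<subseteq> S \<union> set_inv S"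
    "foldr (\<otimes>) ys \<one> = h" using word_length_witness[OF S h] .
  have "S \<union> set_inv S \<subseteq> carrier G" using S by (intro set_inv_subset) (simp add: generates_def)
  then have "foldr (\<otimes>) (xs @ ys) \<one> = g \<otimes> h"
    using foldr_mult_append[OF _ xs(2) ys(2)] xs ys by simp
  then show ?thesis using word_length_le[of "xs @ ys" S "g \<otimes> h"] xs ys by simp
qed

lemma word_length_pow:
  assumes S: "generates G S" and g: "g \<in> carrier G"
  shows "word_length G S (g [^] (n::nat)) \<le> n * word_length G S g"
proof (induction n)
  case (Suc n)
  then show ?case using word_length_mult[OF S nat_pow_closed[OF g] g, of n] by simp
qed (simp add: word_length_one)

lemma word_length_pos:
  assumes "generates G S" "g \<in> carrier G" "g \<noteq> \<one>"
  shows "0 < word_length G S g"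
  by (rule word_length_witness[OF assms(1,2)]) (use assms(3) in \<open>cases "word_length G S g"; simp\<close>)

lemma undistorted_fg_finite:
  assumes fg: "finitely_generated G" and H: "subgroup H G" and fin: "finite H"
  shows "undistorted_fg G H"
proof -
  interpret h: group "G\<lparr>carrier := H\<rparr>" using subgroup_imp_group[OF H] .
  have "generates (G\<lparr>carrier := H\<rparr>) H"
    using h.generate_incl[of H] generate.incl[of _ H "G\<lparr>carrier := H\<rparr>"] by (auto simp: generates_def)
  then have "finitely_generated (G\<lparr>carrier := H\<rparr>)" using fin by (auto simp: finitely_generated_def)
  moreover have "\<exists>C::real. C > 0 \<and>
      (\<forall>h\<in>H. real (word_length (G\<lparr>carrier := H\<rparr>) T h) \<le> C * real (word_length G S h))"
    if S: "generates G S" for S T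
  proof -
    define C where "C = (\<Sum>h\<in>H. word_length (G\<lparr>carrier := H\<rparr>) T h)"
    have *: "word_length (G\<lparr>carrier := H\<rparr>) T h \<le> (C + 1) * word_length G S h" if h: "h \<in> H" for h
    proof (cases "h = \<one>")
      case True
      then show ?thesis using h.word_length_one[of T] by simp
    next
      case False
      have "word_length (G\<lparr>carrier := H\<rparr>) T h \<le> (C + 1) * 1"
        unfolding C_def using member_le_sum[OF h _ fin, of "word_length (G\<lparr>carrier := H\<rparr>) T"] by simp
      also have "\<dots> \<le> (C + 1) * word_length G S h"
        using word_length_pos[OF S subgroup.mem_carrier[OF H h] False] by (intro mult_left_mono) auto
      finally show ?thesis .
    qed
    then have "real (word_length (G\<lparr>carrier := H\<rparr>) T h) \<le> (real C + 1) * real (word_length G S h)"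
      if "h \<in> H" for h
      using of_nat_mono[OF *[OF that], where ?'a = real] by (simp add: algebra_simps)
    then show ?thesis by (intro exI[of _ "real C + 1"]) auto
  qed
  ultimately show ?thesis using fg by (auto simp: undistorted_fg_def)
qed

lemma submultiplicative_word_bound:
  fixes F :: "'a \<Rightarrow> real"
  assumes one: "F \<one> = 1" and ge1: "\<And>g. g \<in> carrier G \<Longrightarrow> 1 \<le> F g"
    and mult: "\<And>g h. g \<in> carrier G \<Longrightarrow> h \<in> carrier G \<Longrightarrow> F (g \<otimes> h) \<le> F g * F h"
    and d: "\<And>s. s \<in> A \<Longrightarrow> F s \<le> d" and A: "A \<subseteq> carrier G" "set ws \<subseteq> A"
  shows "F (foldr (\<otimes>) ws \<one>) \<le> d ^ length ws"
  using A(2)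
proof (induction ws)
  case (Cons w ws)
  have c: "w \<in> carrier G" "foldr (\<otimes>) ws \<one> \<in> carrier G"
    using Cons.prems A foldr_mult_closed[of ws] by auto
  have "F (w \<otimes> foldr (\<otimes>) ws \<one>) \<le> F w * F (foldr (\<otimes>) ws \<one>)" using mult c by blast
  also have "\<dots> \<le> d * d ^ length ws"
    using Cons d[of w] ge1[OF c(1)] ge1[OF c(2)] by (intro mult_mono) auto
  finally show ?case by simp
qed (simp add: one)

lemma int_pow_cases_nat:
  assumes "x \<in> carrier G"
  obtains n :: nat where "x [^] (i::int) = x [^] n" | n :: nat where "x [^] i = inv x [^] n"
proof (cases i rule: int_cases2)
  case (nonneg n)
  then show ?thesis using that(1)[of n] by (simp add: int_pow_int)
next
  case (nonpos n)
  then show ?thesis using that(2)[of n] assms by (simp add: int_pow_neg_int nat_pow_inv)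
qed

lemma finitely_generated_cyclic:
  assumes x: "x \<in> carrier G" and H: "H = range (\<lambda>i::int. x [^] i)"
  shows "subgroup H G" "finitely_generated (G\<lparr>carrier := H\<rparr>)"
proof -
  have g: "generate G {x} = H" using generate_pow[OF x] H by auto
  then show S: "subgroup H G" using generate_is_subgroup[of "{x}"] x by simp
  have "x \<in> H" using generate.incl[of x "{x}" G] g by simp
  then have "generates (G\<lparr>carrier := H\<rparr>) {x}"
    using generate_consistent[of "{x}" H] S g by (simp add: generates_def)
  then show "finitely_generated (G\<lparr>carrier := H\<rparr>)" by (auto simp: finitely_generated_def)
qed

text \<open>
The function \<open>F\<close> is a certificate: it grows at most exponentially along words, so an exponential
lower bound on the powers of \<open>x\<close> forces their word length to be linear in the exponent. The
negative powers need a bound of their own, since \<open>F\<close> need not be symmetric.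
\<close>

lemma undistorted_fg_cyclic:
  fixes F :: "'a \<Rightarrow> real"
  assumes fg: "finitely_generated G"
    and x: "x \<in> carrier G" and H: "H = range (\<lambda>i::int. x [^] i)"
    and one: "F \<one> = 1" and ge1: "\<And>g. g \<in> carrier G \<Longrightarrow> 1 \<le> F g"
    and mult: "\<And>g h. g \<in> carrier G \<Longrightarrow> h \<in> carrier G \<Longrightarrow> F (g \<otimes> h) \<le> F g * F h"
    and r: "1 < r" and grow: "\<And>n::nat. r ^ n \<le> F (x [^] n)" "\<And>n::nat. r ^ n \<le> F (inv x [^] n)"
  shows "undistorted_fg G H"
proof -
  note HS = finitely_generated_cyclic[OF x H]
  interpret h: group "G\<lparr>carrier := H\<rparr>" using subgroup_imp_group[OF HS(1)] .
  have "x [^] (1::int) \<in> H" unfolding H by blast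
  then have xH: "x \<in> H" using x by (simp add: int_pow_1)
  have ixH: "inv x \<in> H" using subgroup.m_inv_closed[OF HS(1) xH] .
  have "\<exists>C::real. C > 0 \<and>
      (\<forall>h\<in>H. real (word_length (G\<lparr>carrier := H\<rparr>) T h) \<le> C * real (word_length G S h))"
    if S: "finite S" "generates G S" and T: "generates (G\<lparr>carrier := H\<rparr>) T" for S T
  proof -
    let ?A = "S \<union> set_inv S" and ?l = "word_length (G\<lparr>carrier := H\<rparr>) T"
    have Ac: "?A \<subseteq> carrier G" using S by (intro set_inv_subset) (simp add: generates_def)
    have "finite ?A" using S by (simp add: SET_INV_def)
    define d where "d = Max (insert 1 (F ` ?A))"
    have d: "1 \<le> d" "\<And>s. s \<in> ?A \<Longrightarrow> F s \<le> d"
      unfolding d_def using \<open>finite ?A\<close> by (auto intro!: Max_ge)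
    define t where "t = ?l x + ?l (inv x)"
    define C where "C = real t * (ln d / ln r) + 1"
    have C: "C > 0" unfolding C_def using d(1) r by (intro add_nonneg_pos mult_nonneg_nonneg) auto
    have "real (?l g) \<le> C * real (word_length G S g)" if g: "g \<in> H" for g
    proof -
      have gc: "g \<in> carrier G" using subgroup.mem_carrier[OF HS(1) g] .
      have pow: "?l (y [^] n) \<le> n * ?l y" if "y \<in> H" for y and n :: nat
        using h.word_length_pow[OF T, of y n] that by (simp add: nat_pow_def)
      have "\<exists>n::nat. ?l g \<le> n * t \<and> r ^ n \<le> F g"
      proof -
        obtain i :: int where i: "g = x [^] i" using g H by blast
        show ?thesis
        proof (rule int_pow_cases_nat[OF x, of i])
          fix n :: nat assume 1: "x [^] i = x [^] n"
          have "n * ?l x \<le> n * t" by (simp add: t_def)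
          then have "?l g \<le> n * t" using order_trans[OF pow[OF xH, of n]] 1 i by simp
          moreover have "r ^ n \<le> F g" using grow(1)[of n] 1 i by simp
          ultimately show ?thesis by blast
        next
          fix n :: nat assume 2: "x [^] i = inv x [^] n"
          have "n * ?l (inv x) \<le> n * t" by (simp add: t_def)
          then have "?l g \<le> n * t" using order_trans[OF pow[OF ixH, of n]] 2 i by simp
          moreover have "r ^ n \<le> F g" using grow(2)[of n] 2 i by simp
          ultimately show ?thesis by blast
        qed
      qed
      then obtain n :: nat where n: "?l g \<le> n * t" "r ^ n \<le> F g" by blast
      obtain ws where ws: "length ws = word_length G S g" "set ws \<subseteq> ?A" "foldr (\<otimes>) ws \<one> = g"
        using word_length_witness[OF S(2) gc] .
      have "r ^ n \<le> d ^ word_length G S g"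
        using n(2) submultiplicative_word_bound[OF one ge1 mult d(2) Ac ws(2)] ws by simp
      then have "ln (r ^ n) \<le> ln (d ^ word_length G S g)"
        using r d(1) by (subst ln_le_cancel_iff) auto
      then have "real n * ln r \<le> real (word_length G S g) * ln d"
        using r d(1) by (simp add: ln_realpow)
      then have "real n \<le> (ln d / ln r) * real (word_length G S g)"
        using r by (simp add: field_simps)
      then have "real t * real n \<le> real t * ((ln d / ln r) * real (word_length G S g))"
        by (intro mult_left_mono) auto
      also have "\<dots> \<le> C * real (word_length G S g)" by (simp add: C_def algebra_simps)
      finally show ?thesis using of_nat_mono[OF n(1), where ?'a = real] by (simp add: mult.commute)
    qed
    then show ?thesis using C by blast
  qed
  then show ?thesis using fg HS(2) by (auto simp: undistorted_fg_def)
qed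

section \<open>Commensurating elements\<close>

lemma conjugate_index_submult:
  assumes U: "subgroup U G" and k: "k \<in> carrier G" and l: "l \<in> carrier G"
    and fin: "finite (rel_cosets G U (conjugate G k U))" "finite (rel_cosets G U (conjugate G l U))"
  shows "rel_index G U (conjugate G (k \<otimes> l) U) \<le>
    rel_index G U (conjugate G k U) * rel_index G U (conjugate G l U)"
proof -
  have e: "conjugate G (k \<otimes> l) U = conjugate G k (conjugate G l U)"
    using k l subgroup.subset[OF U] by (simp add: conjugate_mult)
  note S = subgroup_conjugate[OF _ U]
  show ?thesis
    using rel_index_trans_le[OF U S[OF k] S[OF m_closed[OF k l]] fin(1)] fin(2)
    unfolding e rel_index_conjugate[OF k U S[OF l]] finite_rel_cosets_conjugate_iff[OF k U S[OF l]]
    by simp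
qed

lemma finite_conjugate_commensurable:
  assumes H: "subgroup H G" and U: "subgroup U G" and "U \<subseteq> H"
    and fin: "finite (rel_cosets G H U)" and k: "k \<in> commensurator G H"
  shows "finite (rel_cosets G U (conjugate G k U))"
proof -
  have kc: "k \<in> carrier G" using k by (simp add: commensurator_def)
  have "finite (rel_cosets G H (conjugate G k U))"
    using finite_rel_cosets_trans(2)[OF H subgroup_conjugate[OF kc H] subgroup_conjugate[OF kc U]]
      finite_rel_cosets_conjugate_iff[OF kc H U] fin k by (simp add: mem_commensurator[OF H])
  then show ?thesis by (rule finite_rel_cosets_mono[OF \<open>U \<subseteq> H\<close>])
qed

text \<open>
The growth of the index is assumed for positive powers only. Multiplying the index of \<open>k\<close> by that of
\<open>inv k\<close> makes it symmetric and keeps it submultiplicative, so that the negative powers obey the same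
bound.
\<close>

lemma undistorted_fg_of_exponential_index:
  assumes H: "subgroup H G" and U: "subgroup U G" and "U \<subseteq> H" and fin: "finite (rel_cosets G H U)"
    and K: "subgroup K G" "K \<subseteq> commensurator G H" "finitely_generated (G\<lparr>carrier := K\<rparr>)"
    and x: "x \<in> K" and r: "1 < r"
    and grow: "\<And>n::nat. r ^ n \<le> real (rel_index G U (conjugate G (x [^] n) U))"
  shows "undistorted_fg (G\<lparr>carrier := K\<rparr>) (range (\<lambda>i::int. x [^] i))"
proof -
  interpret K: group "G\<lparr>carrier := K\<rparr>" using subgroup_imp_group[OF K(1)] .
  define f where "f = (\<lambda>k. rel_index G U (conjugate G k U))"
  define F where "F = (\<lambda>k. real (f k * f (inv k)))"
  have c: "k \<in> carrier G" if "k \<in> K" for k using subgroup.mem_carrier[OF K(1) that] .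
  have i: "inv k \<in> K" if "k \<in> K" for k using subgroup.m_inv_closed[OF K(1) that] .
  have fK: "finite (rel_cosets G U (conjugate G k U))" if "k \<in> K" for k
    using finite_conjugate_commensurable[OF H U \<open>U \<subseteq> H\<close> fin] K(2) that by blast
  have pos: "1 \<le> f k" if "k \<in> K" for k
    unfolding f_def using rel_index_pos[OF U fK[OF that]] by simp
  have sub: "f (k \<otimes> l) \<le> f k * f l" if "k \<in> K" "l \<in> K" for k l
    unfolding f_def using conjugate_index_submult[OF U c c fK fK] that by simp
  have xn: "x [^] n \<in> K" for n :: nat
    using subgroup_int_pow_closed[OF K(1) x, of "int n"] by (simp add: int_pow_int)
  have "undistorted_fg (G\<lparr>carrier := K\<rparr>) (range (\<lambda>i::int. x [^]\<^bsub>G\<lparr>carrier := K\<rparr>\<^esub> i))"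
  proof (rule K.undistorted_fg_cyclic[OF K(3) _ refl, where F = F])
    show "x \<in> carrier (G\<lparr>carrier := K\<rparr>)" using x by simp
    show "F \<one>\<^bsub>G\<lparr>carrier := K\<rparr>\<^esub> = 1"
      by (simp add: F_def f_def conjugate_one subgroup.subset[OF U] rel_index_def rel_cosets_self[OF U])
    show "1 \<le> F g" if "g \<in> carrier (G\<lparr>carrier := K\<rparr>)" for g
      using pos[of g] pos[of "inv g"] i[of g] that mult_le_mono[of 1 "f g" 1 "f (inv g)"]
      by (simp add: F_def del: of_nat_mult)
    show "F (g \<otimes>\<^bsub>G\<lparr>carrier := K\<rparr>\<^esub> h) \<le> F g * F h"
      if "g \<in> carrier (G\<lparr>carrier := K\<rparr>)" "h \<in> carrier (G\<lparr>carrier := K\<rparr>)" for g h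
    proof -
      have gh: "g \<in> K" "h \<in> K" using that by auto
      have "f (g \<otimes> h) * f (inv (g \<otimes> h)) \<le> (f g * f h) * (f (inv h) * f (inv g))"
        using sub[OF gh] sub[OF i[OF gh(2)] i[OF gh(1)]] c gh
        by (simp add: inv_mult_group mult_le_mono)
      then have "real (f (g \<otimes> h) * f (inv (g \<otimes> h))) \<le> real ((f g * f h) * (f (inv h) * f (inv g)))"
        by (simp only: of_nat_le_iff)
      then show ?thesis by (simp add: F_def mult_ac)
    qed
    show "1 < r" by (rule r)
    show "r ^ n \<le> F (x [^]\<^bsub>G\<lparr>carrier := K\<rparr>\<^esub> n)" for n :: nat
    proof -
      have "f (x [^] n) * 1 \<le> f (x [^] n) * f (inv (x [^] n))"
        using pos[OF i[OF xn]] by (intro mult_le_mono) auto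
      then have "real (f (x [^] n)) \<le> F (x [^] n)" by (simp add: F_def del: of_nat_mult)
      then show ?thesis using grow[of n] by (simp add: f_def nat_pow_def)
    qed
    show "r ^ n \<le> F (inv\<^bsub>G\<lparr>carrier := K\<rparr>\<^esub> x [^]\<^bsub>G\<lparr>carrier := K\<rparr>\<^esub> n)" for n :: nat
    proof -
      have "f (x [^] n) * 1 \<le> f (x [^] n) * f (inv (x [^] n))"
        using pos[OF i[OF xn]] by (intro mult_le_mono) auto
      then have "real (f (x [^] n)) \<le> F (inv (x [^] n))"
        using c[OF xn] by (simp add: F_def mult.commute del: of_nat_mult)
      then have "r ^ n \<le> F (inv x [^] n)"
        using grow[of n] c[OF x] by (simp add: f_def nat_pow_inv)
      then show ?thesis using m_inv_consistent[OF K(1) x] by (simp add: nat_pow_def)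
    qed
  qed
  then show ?thesis using int_pow_consistent[OF K(1) x] by simp
qed

end

section \<open>Automorphisms of a Cayley graph that fix the identity\<close>

text \<open>
Letters are appended on the right, so that these are the balls around \<open>1\<close> in the Cayley graph.
\<close>

primrec word_ball :: "('a, 'b) monoid_scheme \<Rightarrow> 'a set \<Rightarrow> nat \<Rightarrow> 'a set" where
  "word_ball K S 0 = {\<one>\<^bsub>K\<^esub>}"
| "word_ball K S (Suc n) =
    word_ball K S n \<union> (\<lambda>(g, s). g \<otimes>\<^bsub>K\<^esub> s) ` (word_ball K S n \<times> (S \<union> set_inv\<^bsub>K\<^esub> S))"

locale cayley_graph = group G for G (structure) +
  fixes S
  assumes finite_S: "finite S" and generates_S: "generates G S"
begin

abbreviation B :: "nat \<Rightarrow> 'a set" where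
  "B \<equiv> word_ball G S"

lemma letters_subset: "S \<union> set_inv S \<subseteq> carrier G"
  using generates_S by (intro set_inv_subset) (simp add: generates_def)

lemma finite_B: "finite (B n)"
  using finite_S by (induction n) (simp_all add: SET_INV_def)

lemma B_subset: "B n \<subseteq> carrier G"
  using letters_subset by (induction n) auto

lemma B_step: "v \<in> B n \<Longrightarrow> s \<in> S \<union> set_inv S \<Longrightarrow> v \<otimes> s \<in> B (Suc n)"
  by auto

lemma B_mono: "m \<le> n \<Longrightarrow> B m \<subseteq> B n"
  by (rule lift_Suc_mono_le) auto

lemma mem_some_B:
  assumes "g \<in> carrier G" shows "\<exists>n. g \<in> B n"
proof -
  obtain ws where "set ws \<subseteq> S \<union> set_inv S" "foldr (\<otimes>) ws \<one> = g"
    using generate_word[of S g] assms generates_S by (auto simp: generates_def)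
  moreover have "foldr (\<otimes>) ws \<one> \<in> B (length ws)" if "set ws \<subseteq> S \<union> set_inv S" for ws
    using that
  proof (induction ws rule: rev_induct)
    case (snoc s ws)
    then have s: "set ws \<subseteq> S \<union> set_inv S" "s \<in> S \<union> set_inv S" "set [s] \<subseteq> S \<union> set_inv S" by auto
    have "foldr (\<otimes>) (ws @ [s]) \<one> = foldr (\<otimes>) ws \<one> \<otimes> s"
      using foldr_mult_append[OF letters_subset s(1,3)] s(2) letters_subset by auto
    then show ?case using snoc.IH[OF s(1)] s(2) by auto
  qed simp
  ultimately show ?thesis by blast
qed

text \<open>
The set of cosets of \<open>E\<close> that meet \<open>B n\<close> grows strictly with \<open>n\<close> until it is stable for good, and it
has at most \<open>M\<close> elements. So the radius depends on the index of \<open>E\<close> alone, which is what lets the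
ball be chosen before the power of \<open>\<phi>\<close>.
\<close>

lemma B_covers_cosets:
  assumes E: "subgroup E G" and fin: "finite (rel_cosets G (carrier G) E)"
    and M: "rel_index G (carrier G) E \<le> M" and g: "g \<in> carrier G"
  shows "\<exists>e\<in>E. \<exists>b\<in>B M. g = e \<otimes> b"
proof -
  define Q where "Q = (\<lambda>n. rel_cosets G (B n) E)"
  have Qsub: "Q n \<subseteq> rel_cosets G (carrier G) E" for n
    unfolding Q_def by (rule rel_cosets_mono[OF B_subset])
  have Qfin: "finite (Q n)" for n using Qsub fin by (rule finite_subset)
  have Qmono: "Q m \<subseteq> Q n" if "m \<le> n" for m n
    unfolding Q_def by (rule rel_cosets_mono[OF B_mono[OF that]])
  have "\<exists>n<M. Q (Suc n) = Q n"
  proof (rule ccontr)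
    assume "\<not> (\<exists>n<M. Q (Suc n) = Q n)"
    then have ne: "Q n \<subset> Q (Suc n)" if "n < M" for n using Qmono[of n "Suc n"] that by auto
    have "n \<le> M \<Longrightarrow> n < card (Q n)" for n
    proof (induction n)
      case 0
      show ?case using Qfin[of 0] by (simp add: card_gt_0_iff Q_def rel_cosets_def)
    next
      case (Suc n)
      then show ?case using psubset_card_mono[OF Qfin ne[of n]] by simp
    qed
    then have "M < card (Q M)" by simp
    also have "\<dots> \<le> rel_index G (carrier G) E"
      unfolding rel_index_def by (rule card_mono[OF fin Qsub])
    finally show False using M by simp
  qed
  then obtain n where n: "n < M" "Q (Suc n) = Q n" by blast
  have stable: "Q (n + k) = Q n" for k
  proof (induction k)
    case (Suc k)
    have "Q (n + Suc k) \<subseteq> Q (Suc n)"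
    proof
      fix Z assume "Z \<in> Q (n + Suc k)"
      then obtain w where w: "w \<in> B (Suc (n + k))" "Z = E #> w" by (auto simp: Q_def rel_cosets_def)
      show "Z \<in> Q (Suc n)"
      proof (cases "w \<in> B (n + k)")
        case True
        then have "Z \<in> Q (n + k)" using w by (auto simp: Q_def rel_cosets_def)
        then show ?thesis using Suc n by simp
      next
        case False
        then obtain v s where v: "v \<in> B (n + k)" "s \<in> S \<union> set_inv S" "w = v \<otimes> s" using w(1) by auto
        then have "E #> v \<in> Q n" using Suc by (auto simp: Q_def rel_cosets_def)
        then obtain v' where v': "v' \<in> B n" "E #> v = E #> v'" by (auto simp: Q_def rel_cosets_def)
        have c: "v \<in> carrier G" "v' \<in> carrier G" "s \<in> carrier G"
          using v v' B_subset letters_subset by auto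
        have "E #> w = E #> (v' \<otimes> s)"
          using v' c subgroup.subset[OF E] by (simp add: v(3) coset_mult_assoc[symmetric])
        moreover have "v' \<otimes> s \<in> B (Suc n)" using v' v by auto
        ultimately show ?thesis using w(2) by (auto simp: Q_def rel_cosets_def)
      qed
    qed
    then show ?case using Qmono[of n "n + Suc k"] n(2) by auto
  qed simp
  obtain k where "g \<in> B k" using mem_some_B[OF g] by blast
  then have "g \<in> B (n + k)" using B_mono[of k "n + k"] by auto
  then have "E #> g \<in> Q (n + k)" by (auto simp: Q_def rel_cosets_def)
  then have "E #> g \<in> Q M" using stable[of k] Qmono[of n M] n(1) by auto
  then obtain b where b: "b \<in> B M" "E #> g = E #> b" by (auto simp: Q_def rel_cosets_def)
  then have bc: "b \<in> carrier G" using B_subset by blast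
  then have "g \<otimes> inv b \<in> E" using rcos_eq_iff[OF E g bc] b(2) by simp
  moreover have "g = (g \<otimes> inv b) \<otimes> b" using g bc by (simp add: m_assoc)
  ultimately show ?thesis using b by blast
qed

text \<open>
Induction along a word. A fixed vertex is \<open>v = e b\<close> with \<open>e\<close> in \<open>E\<close> and \<open>b\<close> in the ball of radius
\<open>M\<close>, and since \<open>b\<close> is fixed, so is \<open>e\<close>. The neighbour \<open>v s = e (b s)\<close> is then fixed because \<open>b s\<close>
lies in the ball of radius \<open>M + 1\<close>.
\<close>

lemma fixes_all_of_fixes_ball:
  assumes E: "subgroup E G" and fin: "finite (rel_cosets G (carrier G) E)"
    and M: "rel_index G (carrier G) E \<le> M"
    and \<psi>: "\<psi> \<in> carrier G \<rightarrow> carrier G"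
    and hom: "\<And>e x. e \<in> E \<Longrightarrow> x \<in> carrier G \<Longrightarrow> \<psi> (e \<otimes> x) = \<psi> e \<otimes> \<psi> x"
    and fixed: "\<And>b. b \<in> B (Suc M) \<Longrightarrow> \<psi> b = b"
    and g: "g \<in> carrier G"
  shows "\<psi> g = g"
proof -
  have "\<forall>w\<in>B n. \<psi> w = w" for n
  proof (induction n)
    case 0
    show ?case using fixed B_mono[of 0 "Suc M"] by auto
  next
    case (Suc n)
    show ?case
    proof
      fix w assume w: "w \<in> B (Suc n)"
      show "\<psi> w = w"
      proof (cases "w \<in> B n")
        case False
        then obtain v s where v: "v \<in> B n" "s \<in> S \<union> set_inv S" "w = v \<otimes> s" using w by auto
        have c: "v \<in> carrier G" "s \<in> carrier G" using v B_subset letters_subset by auto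
        obtain e b where eb: "e \<in> E" "b \<in> B M" "v = e \<otimes> b"
          using B_covers_cosets[OF E fin M c(1)] by blast
        have c': "e \<in> carrier G" "b \<in> carrier G" "\<psi> e \<in> carrier G"
          using eb B_subset subgroup.mem_carrier[OF E] \<psi> by auto
        have "\<psi> b = b" using eb(2) fixed by auto
        then have "\<psi> e \<otimes> b = e \<otimes> b" using hom[OF eb(1) c'(2)] Suc v(1) eb(3) by metis
        then have "\<psi> e = e" using c' by simp
        moreover have "\<psi> (b \<otimes> s) = b \<otimes> s" using fixed[OF B_step[OF eb(2) v(2)]] .
        moreover have "w = e \<otimes> (b \<otimes> s)" using v(3) eb(3) c c' by (simp add: m_assoc)
        ultimately show ?thesis using hom[OF eb(1), of "b \<otimes> s"] c c' by simp
      qed (use Suc in blast)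
    qed
  qed
  then show ?thesis using mem_some_B[OF g] by blast
qed

abbreviation \<Gamma> :: "('a \<Rightarrow> 'a) monoid" where
  "\<Gamma> \<equiv> Aut (Cay G S)"

abbreviation translation :: "'a \<Rightarrow> 'a \<Rightarrow> 'a" where
  "translation g \<equiv> \<lambda>x\<in>carrier G. g \<otimes> x"

sublocale A: group \<Gamma> by (rule group_Aut)

lemma subgroup_translations: "subgroup (left_translations G) \<Gamma>"
  by (rule subgroup_left_translations) (use generates_S in \<open>simp add: generates_def\<close>)

lemma A_bij: "\<psi> \<in> carrier \<Gamma> \<Longrightarrow> bij_betw \<psi> (carrier G) (carrier G)"
  by (simp add: Aut_def graph_auto_def Bij_def Cay_def)

lemma A_extensional: "\<psi> \<in> carrier \<Gamma> \<Longrightarrow> \<psi> \<in> extensional (carrier G)"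
  by (simp add: Aut_def graph_auto_def Bij_def Cay_def)

lemma A_closed: "\<psi> \<in> carrier \<Gamma> \<Longrightarrow> x \<in> carrier G \<Longrightarrow> \<psi> x \<in> carrier G"
  using A_bij bij_betwE by blast

lemma A_mult: "\<psi> \<in> carrier \<Gamma> \<Longrightarrow> \<chi> \<in> carrier \<Gamma> \<Longrightarrow> x \<in> carrier G \<Longrightarrow> (\<psi> \<otimes>\<^bsub>\<Gamma>\<^esub> \<chi>) x = \<psi> (\<chi> x)"
  by (simp add: Aut_def graph_auto_def BijGroup_def Cay_def compose_eq)

lemma A_one: "\<one>\<^bsub>\<Gamma>\<^esub> = (\<lambda>x\<in>carrier G. x)"
  by (simp add: Aut_def BijGroup_def Cay_def)

lemma A_inv:
  assumes "\<psi> \<in> carrier \<Gamma>" "x \<in> carrier G"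
  shows "(inv\<^bsub>\<Gamma>\<^esub> \<psi>) (\<psi> x) = x"
  using A_mult[OF A.inv_closed[OF assms(1)] assms] assms by (simp add: A_one)

lemma translation_mem: "g \<in> carrier G \<Longrightarrow> translation g \<in> left_translations G"
  by (simp add: left_translations_def)

lemma translation_closed: "g \<in> carrier G \<Longrightarrow> translation g \<in> carrier \<Gamma>"
  using translation_mem subgroup.mem_carrier[OF subgroup_translations] by blast

lemma A_ext:
  assumes "\<psi> \<in> carrier \<Gamma>" "\<chi> \<in> carrier \<Gamma>" "\<And>x. x \<in> carrier G \<Longrightarrow> \<psi> x = \<chi> x"
  shows "\<psi> = \<chi>"
  using extensionalityI[OF A_extensional A_extensional] assms by blast

lemma translation_mult:
  assumes "g \<in> carrier G" "h \<in> carrier G"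
  shows "translation (g \<otimes> h) = translation g \<otimes>\<^bsub>\<Gamma>\<^esub> translation h"
  by (rule A_ext) (use assms in \<open>simp_all add: translation_closed A_mult m_assoc\<close>)

lemma translation_one: "translation \<one> = \<one>\<^bsub>\<Gamma>\<^esub>"
  by (auto simp: A_one)

lemma translation_inv:
  assumes "g \<in> carrier G" shows "translation (inv g) = inv\<^bsub>\<Gamma>\<^esub> (translation g)"
  using translation_mult[of "inv g" g] assms A.inv_equality translation_closed translation_one by simp

lemma A_preserves_B:
  assumes \<psi>: "\<psi> \<in> carrier \<Gamma>" "\<psi> \<one> = \<one>"
  shows "\<psi> ` B n \<subseteq> B n"
proof (induction n)
  case (Suc n)
  show ?case
  proof (rule image_subsetI)
    fix w assume w: "w \<in> B (Suc n)"
    show "\<psi> w \<in> B (Suc n)"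
    proof (cases "w \<in> B n")
      case False
      then obtain v s where v: "v \<in> B n" "s \<in> S \<union> set_inv S" "w = v \<otimes> s" using w by auto
      have c: "v \<in> carrier G" "w \<in> carrier G" using subsetD[OF B_subset v(1)] subsetD[OF B_subset w] .
      have "(v, w) \<in> parcs (Cay G S)" using v c by (auto simp: Cay_def)
      then have "(\<psi> v, \<psi> w) \<in> parcs (Cay G S)"
        using \<psi>(1) c by (simp add: Aut_def graph_auto_def Cay_def)
      then obtain t where "t \<in> S \<union> set_inv S" "\<psi> w = \<psi> v \<otimes> t" by (auto simp: Cay_def)
      moreover have "\<psi> v \<in> B n" using Suc v by blast
      ultimately show ?thesis by auto
    qed (use Suc in auto)
  qed
qed (use \<psi> in simp)

lemma A_pow_one:
  assumes "\<psi> \<in> carrier \<Gamma>" "\<psi> \<one> = \<one>"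
  shows "(\<psi> [^]\<^bsub>\<Gamma>\<^esub> (n::nat)) \<one> = \<one>"
  by (induction n) (use assms in \<open>simp_all add: A_one A_mult\<close>)

text \<open>
The powers of \<open>\<psi>\<close> permute the finite set \<open>B n\<close>, so two of them agree on it.
\<close>

lemma power_fixes_ball:
  assumes \<psi>: "\<psi> \<in> carrier \<Gamma>" "\<psi> \<one> = \<one>"
  shows "\<exists>q::nat. 0 < q \<and> (\<forall>b\<in>B n. (\<psi> [^]\<^bsub>\<Gamma>\<^esub> q) b = b)"
proof -
  have c: "\<psi> [^]\<^bsub>\<Gamma>\<^esub> (k::nat) \<in> carrier \<Gamma>" for k using \<psi> by simp
  let ?r = "\<lambda>k::nat. restrict (\<psi> [^]\<^bsub>\<Gamma>\<^esub> k) (B n)"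
  have "(\<psi> [^]\<^bsub>\<Gamma>\<^esub> k) b \<in> B n" if "b \<in> B n" for k :: nat and b
    using A_preserves_B[OF c A_pow_one[OF \<psi>], of k n] that by (simp add: image_subset_iff)
  then have "range ?r \<subseteq> B n \<rightarrow>\<^sub>E B n" by (auto simp: PiE_iff)
  then have "finite (range ?r)" using finite_PiE[OF finite_B] finite_B finite_subset by metis
  then have "\<not> inj ?r" using finite_imageD infinite_UNIV_nat by blast
  then obtain i' j' where "?r i' = ?r j'" "i' \<noteq> j'" by (auto simp: inj_on_def)
  then obtain i j where ij: "?r i = ?r j" "i < j" by (metis linorder_neqE_nat)
  have "(\<psi> [^]\<^bsub>\<Gamma>\<^esub> (j - i)) b = b" if b: "b \<in> B n" for b
  proof -
    have bc: "b \<in> carrier G" using b B_subset by blast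
    have "\<psi> [^]\<^bsub>\<Gamma>\<^esub> j = \<psi> [^]\<^bsub>\<Gamma>\<^esub> i \<otimes>\<^bsub>\<Gamma>\<^esub> \<psi> [^]\<^bsub>\<Gamma>\<^esub> (j - i)"
      using ij(2) \<psi>(1) by (simp add: A.nat_pow_mult)
    then have "(\<psi> [^]\<^bsub>\<Gamma>\<^esub> j) b = (\<psi> [^]\<^bsub>\<Gamma>\<^esub> i) ((\<psi> [^]\<^bsub>\<Gamma>\<^esub> (j - i)) b)"
      using A_mult[OF c c bc] by simp
    moreover have "(\<psi> [^]\<^bsub>\<Gamma>\<^esub> j) b = (\<psi> [^]\<^bsub>\<Gamma>\<^esub> i) b"
      using fun_cong[OF ij(1), of b] b by simp
    ultimately show ?thesis
      using bij_betw_imp_inj_on[OF A_bij[OF c[of i]]] A_closed[OF c[of "j - i"] bc] bc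
      by (simp add: inj_on_eq_iff)
  qed
  then show ?thesis using ij(2) by (intro exI[of _ "j - i"]) simp
qed

text \<open>
The identification of \<open>G\<close> with its group of translations carries subgroups of finite index back
to \<open>G\<close>, where word lengths are available.
\<close>

lemma translation_preimage:
  assumes E: "subgroup E \<Gamma>" and fin: "finite (rel_cosets \<Gamma> (left_translations G) E)"
  defines "E' \<equiv> {g \<in> carrier G. translation g \<in> E}"
  shows "subgroup E' G" "finite (rel_cosets G (carrier G) E')"
    "rel_index G (carrier G) E' \<le> rel_index \<Gamma> (left_translations G) E"
proof -
  show E': "subgroup E' G"
  proof (rule subgroupI)
    show "E' \<subseteq> carrier G" by (auto simp: E'_def)
    have "\<one> \<in> E'" using subgroup.one_closed[OF E] unfolding E'_def translation_one[symmetric] by simp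
    then show "E' \<noteq> {}" by blast
    show "inv a \<in> E'" if "a \<in> E'" for a
    proof -
      have a: "a \<in> carrier G" "translation a \<in> E" using that by (auto simp: E'_def)
      show ?thesis
        unfolding E'_def using a translation_inv[OF a(1)] subgroup.m_inv_closed[OF E a(2)] by simp
    qed
    show "a \<otimes> b \<in> E'" if "a \<in> E'" "b \<in> E'" for a b
    proof -
      have a: "a \<in> carrier G" "translation a \<in> E" "b \<in> carrier G" "translation b \<in> E"
        using that by (auto simp: E'_def)
      show ?thesis unfolding E'_def
        using a translation_mult[OF a(1,3)] subgroup.m_closed[OF E a(2,4)] by simp
    qed
  qed
  let ?p = "\<lambda>Q. {g \<in> carrier G. translation g \<in> Q}"
  have coset: "E' #> a = ?p (E #>\<^bsub>\<Gamma>\<^esub> translation a)" if a: "a \<in> carrier G" for a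
  proof -
    have "g \<in> E' #> a \<longleftrightarrow> translation g \<in> E #>\<^bsub>\<Gamma>\<^esub> translation a" if g: "g \<in> carrier G" for g
    proof -
      note t = translation_closed[OF g] translation_closed[OF a]
      have "g \<in> E' #> a \<longleftrightarrow> E' #> g = E' #> a"
        using rcos_self[OF g E'] repr_independence[OF _ a E', of g] by auto
      also have "\<dots> \<longleftrightarrow> g \<otimes> inv a \<in> E'" using rcos_eq_iff[OF E' g a] .
      also have "\<dots> \<longleftrightarrow> translation g \<otimes>\<^bsub>\<Gamma>\<^esub> inv\<^bsub>\<Gamma>\<^esub> translation a \<in> E"
        unfolding E'_def using g a translation_mult[of g "inv a"] translation_inv[OF a] by simp
      also have "\<dots> \<longleftrightarrow> E #>\<^bsub>\<Gamma>\<^esub> translation g = E #>\<^bsub>\<Gamma>\<^esub> translation a"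
        using A.rcos_eq_iff[OF E t] by simp
      also have "\<dots> \<longleftrightarrow> translation g \<in> E #>\<^bsub>\<Gamma>\<^esub> translation a"
        using A.rcos_self[OF t(1) E] A.repr_independence[OF _ t(2) E, of "translation g"] by auto
      finally show ?thesis .
    qed
    moreover have "E' #> a \<subseteq> carrier G" by (rule r_coset_subset_G[OF subgroup.subset[OF E'] a])
    ultimately show ?thesis by auto
  qed
  have im: "rel_cosets G (carrier G) E' = ?p ` rel_cosets \<Gamma> (left_translations G) E"
    unfolding rel_cosets_def left_translations_def image_image
    by (rule image_cong[OF refl]) (rule coset)
  show "finite (rel_cosets G (carrier G) E')" unfolding im using fin by (rule finite_imageI)
  show "rel_index G (carrier G) E' \<le> rel_index \<Gamma> (left_translations G) E"
    unfolding rel_index_def im using fin by (rule card_image_le)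
qed

text \<open>
The bound \<open>N\<close> on the index of \<open>E = U \<inter> \<phi>^q U \<phi>^-q\<close> in the group of translations holds for all \<open>q\<close>
at once, so \<open>q\<close> can be chosen such that \<open>\<phi>^q\<close> fixes the ball of radius \<open>N + 1\<close>. Conjugation by \<open>\<phi>^-q\<close>
takes the translations in \<open>E\<close> to translations, which says that \<open>\<phi>^-q\<close> is multiplicative on \<open>E\<close>.
\<close>

lemma finite_order_of_bounded_index:
  assumes U: "subgroup U \<Gamma>" "U \<subseteq> left_translations G" "finite (rel_cosets \<Gamma> (left_translations G) U)"
    and \<phi>: "\<phi> \<in> commensurator \<Gamma> (left_translations G)" "\<phi> \<one> = \<one>"
    and M: "\<And>n::nat. rel_index \<Gamma> U (conjugate \<Gamma> (\<phi> [^]\<^bsub>\<Gamma>\<^esub> n) U) \<le> M"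
  shows "\<exists>q::nat. 0 < q \<and> \<phi> [^]\<^bsub>\<Gamma>\<^esub> q = \<one>\<^bsub>\<Gamma>\<^esub>"
proof -
  let ?H = "left_translations G"
  note H = subgroup_translations
  have \<phi>c: "\<phi> \<in> carrier \<Gamma>" using \<phi>(1) by (simp add: commensurator_def)
  define N where "N = rel_index \<Gamma> ?H U * M"
  obtain q :: nat where q: "0 < q" "\<And>b. b \<in> B (Suc N) \<Longrightarrow> (\<phi> [^]\<^bsub>\<Gamma>\<^esub> q) b = b"
    using power_fixes_ball[OF \<phi>c \<phi>(2), of "Suc N"] by blast
  define \<chi> where "\<chi> = \<phi> [^]\<^bsub>\<Gamma>\<^esub> q"
  have \<chi>: "\<chi> \<in> carrier \<Gamma>" "\<chi> \<one> = \<one>" using \<phi>c A_pow_one[OF \<phi>c \<phi>(2)] by (auto simp: \<chi>_def)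
  have \<chi>comm: "\<chi> \<in> commensurator \<Gamma> ?H"
    using A.subgroup_int_pow_closed[OF A.subgroup_commensurator[OF H] \<phi>(1), of "int q"]
    by (simp add: \<chi>_def int_pow_int)
  define \<psi> where "\<psi> = inv\<^bsub>\<Gamma>\<^esub> \<chi>"
  have \<psi>: "\<psi> \<in> carrier \<Gamma>" using \<chi> by (simp add: \<psi>_def)
  have \<psi>\<chi>: "\<psi> (\<chi> x) = x" if "x \<in> carrier G" for x using A_inv[OF \<chi>(1) that] by (simp add: \<psi>_def)
  have \<psi>B: "\<psi> b = b" if "b \<in> B (Suc N)" for b
    using \<psi>\<chi>[OF subsetD[OF B_subset that]] q(2)[OF that] by (simp add: \<chi>_def)
  have \<psi>1: "\<psi> \<one> = \<one>" using \<psi>\<chi>[of \<one>] \<chi>(2) by simp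
  note C = A.subgroup_conjugate[OF \<chi>(1) U(1)]
  define E where "E = U \<inter> conjugate \<Gamma> \<chi> U"
  have E: "subgroup E \<Gamma>" unfolding E_def by (rule A.subgroups_Inter_pair[OF U(1) C])
  have HU: "?H \<inter> U = U" using U(2) by blast
  have "finite (rel_cosets \<Gamma> U (conjugate \<Gamma> \<chi> U))"
    by (rule A.finite_conjugate_commensurable[OF H U \<chi>comm])
  then have finE: "finite (rel_cosets \<Gamma> ?H E)"
    unfolding E_def using A.finite_rel_cosets_Int_iff[OF H U(1) C] U(3) HU by simp
  have indE: "rel_index \<Gamma> ?H E \<le> N"
    unfolding E_def N_def using A.rel_index_Int[OF H U(1) C] HU M[of q] by (simp add: \<chi>_def)
  note E' = translation_preimage[OF E finE]
  have "\<psi> g = g" if g: "g \<in> carrier G" for g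
  proof (rule fixes_all_of_fixes_ball[OF E'(1,2) order_trans[OF E'(3) indE] _ _ \<psi>B g])
    show "\<psi> \<in> carrier G \<rightarrow> carrier G" using A_closed[OF \<psi>] by blast
    fix e x assume e: "e \<in> {g \<in> carrier G. translation g \<in> E}" and x: "x \<in> carrier G"
    then have ec: "e \<in> carrier G" and "translation e \<in> conjugate \<Gamma> \<chi> U" by (auto simp: E_def)
    then have "\<psi> \<otimes>\<^bsub>\<Gamma>\<^esub> translation e \<otimes>\<^bsub>\<Gamma>\<^esub> \<chi> \<in> ?H"
      using A.mem_conjugate[OF \<chi>(1) subgroup.subset[OF U(1)]] U(2) by (auto simp: \<psi>_def)
    then obtain h where h: "h \<in> carrier G" "\<psi> \<otimes>\<^bsub>\<Gamma>\<^esub> translation e \<otimes>\<^bsub>\<Gamma>\<^esub> \<chi> = translation h"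
      by (auto simp: left_translations_def)
    have te: "translation e \<in> carrier \<Gamma>" using translation_closed[OF ec] .
    have "\<psi> (e \<otimes> y) = h \<otimes> \<psi> y" if y: "y \<in> carrier G" for y
    proof -
      have "\<psi> \<otimes>\<^bsub>\<Gamma>\<^esub> translation e = translation h \<otimes>\<^bsub>\<Gamma>\<^esub> \<psi>"
        using \<psi> te \<chi>(1) by (simp add: h(2)[symmetric] A.m_assoc \<psi>_def)
      then have "(\<psi> \<otimes>\<^bsub>\<Gamma>\<^esub> translation e) y = (translation h \<otimes>\<^bsub>\<Gamma>\<^esub> \<psi>) y" by simp
      then show ?thesis
        using A_mult[OF \<psi> te y] A_mult[OF translation_closed[OF h(1)] \<psi> y] y A_closed[OF \<psi> y] by simp
    qed
    from this[OF x] this[OF one_closed] show "\<psi> (e \<otimes> x) = \<psi> e \<otimes> \<psi> x"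
      using \<psi>1 ec h(1) by simp
  qed
  then have "\<psi> = \<one>\<^bsub>\<Gamma>\<^esub>" using A_ext[OF \<psi> A.one_closed] by (simp add: A_one)
  then have "\<chi> = \<one>\<^bsub>\<Gamma>\<^esub>" using \<chi>(1) by (simp add: \<psi>_def)
  then show ?thesis using q(1) by (auto simp: \<chi>_def)
qed

lemma subgroup_C1: "subgroup (carrier (C1 G (Cay G S))) \<Gamma>"
proof -
  have "subgroup (stabilizer \<Gamma> (\<lambda>\<phi>. \<phi>) \<one>) \<Gamma>"
  proof (rule A.subgroupI)
    show "stabilizer \<Gamma> (\<lambda>\<phi>. \<phi>) \<one> \<subseteq> carrier \<Gamma>" by (auto simp: stabilizer_def)
    have "\<one>\<^bsub>\<Gamma>\<^esub> \<in> stabilizer \<Gamma> (\<lambda>\<phi>. \<phi>) \<one>" unfolding stabilizer_def using A.one_closed by (simp add: A_one)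
    then show "stabilizer \<Gamma> (\<lambda>\<phi>. \<phi>) \<one> \<noteq> {}" by blast
    show "inv\<^bsub>\<Gamma>\<^esub> a \<in> stabilizer \<Gamma> (\<lambda>\<phi>. \<phi>) \<one>" if "a \<in> stabilizer \<Gamma> (\<lambda>\<phi>. \<phi>) \<one>" for a
      using that A_inv[of a \<one>] by (simp add: stabilizer_def)
    show "a \<otimes>\<^bsub>\<Gamma>\<^esub> b \<in> stabilizer \<Gamma> (\<lambda>\<phi>. \<phi>) \<one>"
      if "a \<in> stabilizer \<Gamma> (\<lambda>\<phi>. \<phi>) \<one>" "b \<in> stabilizer \<Gamma> (\<lambda>\<phi>. \<phi>) \<one>" for a b
      using that by (simp add: stabilizer_def A_mult)
  qed
  then show ?thesis
    by (simp add: C1_def A.subgroups_Inter_pair A.subgroup_commensurator[OF subgroup_translations])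
qed

end

lemma (in group) finite_powers:
  assumes x: "x \<in> carrier G" and q: "0 < q" "x [^] (q::nat) = \<one>"
  shows "finite (range (\<lambda>i::int. x [^] i))"
proof (rule finite_subset)
  have "x [^] i = x [^] (i mod int q)" for i :: int
  proof -
    have "x [^] i = x [^] (int q * (i div int q) + i mod int q)" by simp
    also have "\<dots> = (x [^] int q) [^] (i div int q) \<otimes> x [^] (i mod int q)"
      using x by (simp only: int_pow_mult int_pow_pow)
    finally show ?thesis using x q by (simp add: int_pow_int)
  qed
  then show "range (\<lambda>i::int. x [^] i) \<subseteq> (\<lambda>i. x [^] i) ` {0..<int q}"
    using q(1) by (auto intro!: image_eqI[of _ _ "_ mod int q"])
qed simp

lemma (in cayley_graph) undistorted_cyclic_C1:
  assumes H: "subgroup H (C1 G (Cay G S))" and cyc: "cyclic_group ((C1 G (Cay G S))\<lparr>carrier := H\<rparr>)"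
  shows "undistorted (C1 G (Cay G S)) H"
proof -
  let ?C = "carrier (C1 G (Cay G S))"
  let ?L = "left_translations G"
  have C1: "C1 G (Cay G S) = \<Gamma>\<lparr>carrier := ?C\<rparr>" by (simp add: C1_def)
  have upd: "(C1 G (Cay G S))\<lparr>carrier := J\<rparr> = \<Gamma>\<lparr>carrier := J\<rparr>" for J by (simp add: C1_def)
  have Ccomm: "?C \<subseteq> commensurator \<Gamma> ?L" by (auto simp: C1_def)
  have Cone: "\<psi> \<one> = \<one>" if "\<psi> \<in> ?C" for \<psi> using that by (simp add: C1_def stabilizer_def)
  have sub: "subgroup J \<Gamma>" if "subgroup J (C1 G (Cay G S))" for J
    using A.incl_subgroup[OF subgroup_C1, of J] that C1 by simp
  have HA: "subgroup H \<Gamma>" by (rule sub[OF H])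
  have HC: "H \<subseteq> ?C" using subgroup.subset[OF H] .
  interpret h: group "\<Gamma>\<lparr>carrier := H\<rparr>" by (rule A.subgroup_imp_group[OF HA])
  obtain x where x: "x \<in> H" "H = range (\<lambda>i::int. x [^]\<^bsub>\<Gamma>\<lparr>carrier := H\<rparr>\<^esub> i)"
    using cyc h.cyclic_group by (auto simp: upd)
  then have Hx: "H = range (\<lambda>i::int. x [^]\<^bsub>\<Gamma>\<^esub> i)" using A.int_pow_consistent[OF HA x(1)] by simp
  have xc: "x \<in> carrier \<Gamma>" using subgroup.mem_carrier[OF HA x(1)] .
  have xcomm: "x \<in> commensurator \<Gamma> ?L" and x1: "x \<one> = \<one>" using x(1) HC Ccomm Cone by auto
  obtain U where U: "subgroup U \<Gamma>" "U \<subseteq> ?L" "finite (rel_cosets \<Gamma> ?L U)"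
    "(\<exists>M. \<forall>n::nat. rel_index \<Gamma> U (conjugate \<Gamma> (x [^]\<^bsub>\<Gamma>\<^esub> n) U) \<le> M) \<or>
     (\<exists>r>1. \<forall>n::nat. r ^ n \<le> real (rel_index \<Gamma> U (conjugate \<Gamma> (x [^]\<^bsub>\<Gamma>\<^esub> n) U)))"
    by (rule A.conjugate_index_dichotomy[OF subgroup_translations xcomm])
  have "undistorted_fg (\<Gamma>\<lparr>carrier := K\<rparr>) H"
    if K: "subgroup K (C1 G (Cay G S))" "finitely_generated (\<Gamma>\<lparr>carrier := K\<rparr>)" "H \<subseteq> K" for K
  proof -
    have KA: "subgroup K \<Gamma>" by (rule sub[OF K(1)])
    interpret k: group "\<Gamma>\<lparr>carrier := K\<rparr>" by (rule A.subgroup_imp_group[OF KA])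
    have HK: "subgroup H (\<Gamma>\<lparr>carrier := K\<rparr>)" by (rule A.subgroup_incl[OF HA KA K(3)])
    from U(4) show ?thesis
    proof
      assume "\<exists>M. \<forall>n::nat. rel_index \<Gamma> U (conjugate \<Gamma> (x [^]\<^bsub>\<Gamma>\<^esub> n) U) \<le> M"
      then obtain q :: nat where "0 < q" "x [^]\<^bsub>\<Gamma>\<^esub> q = \<one>\<^bsub>\<Gamma>\<^esub>"
        using finite_order_of_bounded_index[OF U(1-3) xcomm x1] by blast
      then have "finite H" unfolding Hx by (rule A.finite_powers[OF xc])
      then show ?thesis by (rule k.undistorted_fg_finite[OF K(2) HK])
    next
      assume "\<exists>r>1. \<forall>n::nat. r ^ n \<le> real (rel_index \<Gamma> U (conjugate \<Gamma> (x [^]\<^bsub>\<Gamma>\<^esub> n) U))"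
      then obtain r :: real where r: "1 < r"
        "\<And>n::nat. r ^ n \<le> real (rel_index \<Gamma> U (conjugate \<Gamma> (x [^]\<^bsub>\<Gamma>\<^esub> n) U))" by blast
      have "K \<subseteq> commensurator \<Gamma> ?L" using subgroup.subset[OF K(1)] Ccomm by blast
      moreover have "x \<in> K" using x(1) K(3) by blast
      ultimately show ?thesis
        unfolding Hx
        using A.undistorted_fg_of_exponential_index[OF subgroup_translations U(1-3) KA _ K(2) _ r] by blast
    qed
  qed
  moreover have "finitely_generated (\<Gamma>\<lparr>carrier := H\<rparr>)"
    by (rule A.finitely_generated_cyclic(2)[OF xc Hx])
  ultimately show ?thesis by (simp add: undistorted_def upd)
qed

theorem corollaryF:
  fixes G :: "('a, 'b) monoid_scheme" and X :: "'a pair_pre_digraph"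
  assumes "group G" and "finitely_generated G" and "is_cayley_graph G X"
  shows "\<forall>H. subgroup H (C1 G X) \<longrightarrow> cyclic_group ((C1 G X)\<lparr>carrier := H\<rparr>) \<longrightarrow>
    undistorted (C1 G X) H"
proof -
  obtain S where S: "finite S" "generates G S" "X = Cay G S"
    using assms(3) by (auto simp: is_cayley_graph_def)
  interpret cayley_graph G S
    by (intro cayley_graph.intro cayley_graph_axioms.intro assms(1) S)
  show ?thesis using undistorted_cyclic_C1 by (simp add: S(3))
qed

end
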